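(* Let $X_{\mathrm{AH}}$ be a Banach space which has very few operators, has a shrinking Schauder basis, and whose dual space is isomorphic to $\ell_1$. Let $Y$ be a closed, infinite-dimensional subspace of $X_{\mathrm{AH}}$ such that: (i) $Y$ is the closed linear span of a subsequence of the Schauder basis for $X_{\mathrm{AH}}$; (ii) $Y$ has infinite codimension in $X_{\mathrm{AH}}$; (iii) $Y^*$ is isomorphic to $\ell_1$; (iv) every bounded operator from $Y$ into $X_{\mathrm{AH}}$ is the sum of a scalar multiple of the inclusion map $J\colon Y\to X_{\mathrm{AH}}$ and a compact operator. Let $Z=X_{\mathrm{AH}}\oplus Y$, and let $\mathscr{M}_1,\mathscr{M}_2\subseteq\mathscr{B}(Z)$ be as defined in the context. Then the Banach algebra $\mathscr{B}(Z)$ of bounded operators on $Z$ contains exactly six closed two-sided ideals, namely $$\{0\},\quad \mathscr{K}(Z),\quad \mathscr{E}(Z)=\mathscr{M}_1\cap\mathscr{M}_2,\quad \mathscr{M}_1,\quad \mathscr{M}_2,\quad \mathscr{B}(Z),$$ and their lattice is given by the proper inclusions $\{0\}\subsetneq\mathscr{K}(Z)\subsetneq\mathscr{E}(Z)$, $\mathscr{E}(Z)\subsetneq\mathscr{M}_1\subsetneq\mathscr{B}(Z)$ and $\mathscr{E}(Z)\subsetneq\mathscr{M}_2\subsetneq\mathscr{B}(Z)$, with $\mathscr{M}_1$ and $\mathscr{M}_2$ incomparable.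
   Context: The scalar field is $\mathbb{K}=\mathbb{R}$ or $\mathbb{C}$. A Banach space $E$ has very few operators if $E$ is infinite-dimensional and $\mathscr{B}(E)=\mathbb{K}I_E+\mathscr{K}(E)$, where $\mathscr{B}(E)$ is the algebra of bounded operators and $\mathscr{K}(E)$ the ideal of compact operators on $E$. $Z$ carries the norm $\|(x,y)\|=\max\{\|x\|,\|y\|\}$. Under the stated assumptions every $T\in\mathscr{B}(Z)$ has a unique representation as an operator-valued matrix $$T=\begin{pmatrix}\alpha_{1,1}I_{X_{\mathrm{AH}}}+K_{1,1} & \alpha_{1,2}J+K_{1,2}\\ K_{2,1} & \alpha_{2,2}I_Y+K_{2,2}\end{pmatrix}$$ with $\alpha_{1,1},\alpha_{1,2},\alpha_{2,2}\in\mathbb{K}$ and compact operators $K_{1,1}\colon X_{\mathrm{AH}}\to X_{\mathrm{AH}}$, $K_{1,2}\colon Y\to X_{\mathrm{AH}}$, $K_{2,1}\colon X_{\mathrm{AH}}\to Y$, $K_{2,2}\colon Y\to Y$. Define $\mathscr{M}_1=\{T\in\mathscr{B}(Z):\alpha_{2,2}=0\}$ and $\mathscr{M}_2=\{T\in\mathscr{B}(Z):\alpha_{1,1}=0\}$. $\mathscr{E}(Z)$ denotes the set of inessential operators: those $T\in\mathscr{B}(Z)$ whose image in $\mathscr{B}(Z)/\overline{\mathscr{F}(Z)}$ lies in the Jacobson radical of this quotient algebra, where $\overline{\mathscr{F}(Z)}$ is the norm-closure of the ideal of finite-rank operators. *)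

theory Defs
  imports "HOL-Analysis.Analysis" "HOL-Algebra.QuotRing"
begin

section \<open>Banach spaces over the scalar field\<close>

text \<open>
  The scalar field is a type \<open>'k\<close> of class \<open>{real_normed_field, euclidean_space}\<close>. Up to isometric
  isomorphism the only such fields are \<open>real\<close> and \<open>complex\<close>: a finite-dimensional commutative real
  division algebra is one of these two, and its multiplicative norm is the usual absolute value.
  A Banach space over \<open>'k\<close> is a type of class \<open>banach\<close> with a scalar multiplication extending
  \<open>scaleR\<close>.
\<close>

locale kbanach = vector_space scale
  for scale :: "'k::{real_normed_field,euclidean_space} \<Rightarrow> 'x::banach \<Rightarrow> 'x" +
  assumes scale_of_real: "scale (of_real r) x = r *\<^sub>R x"
    and norm_scale: "norm (scale c x) = norm c * norm x"

lemma kbanach_real: "kbanach ((*\<^sub>R) :: real \<Rightarrow> 'x::banach \<Rightarrow> 'x)"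
  by unfold_locales (simp_all add: algebra_simps)

lemma kbanach_scalars:
  "kbanach ((*) :: 'k::{real_normed_field,euclidean_space} \<Rightarrow> 'k \<Rightarrow> 'k)"
  by unfold_locales (simp_all add: algebra_simps norm_mult scaleR_conv_of_real)

definition infinite_dim :: "('k::field \<Rightarrow> 'x::ab_group_add \<Rightarrow> 'x) \<Rightarrow> bool" where
  "infinite_dim s \<longleftrightarrow> (\<nexists>B. finite B \<and> module.span s B = UNIV)"

text \<open>For a subspace \<open>S\<close>: the quotient of the whole space by \<open>S\<close> is not spanned by finitely many
  cosets.\<close>

definition infinite_codim :: "('k::field \<Rightarrow> 'x::ab_group_add \<Rightarrow> 'x) \<Rightarrow> 'x set \<Rightarrow> bool" where
  "infinite_codim s S \<longleftrightarrow> (\<nexists>B. finite B \<and> module.span s (S \<union> B) = UNIV)"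


section \<open>Bounded, compact and finite-rank operators\<close>

definition bounded_ops ::
  "('k \<Rightarrow> 'x::real_normed_vector \<Rightarrow> 'x) \<Rightarrow> ('k \<Rightarrow> 'y::real_normed_vector \<Rightarrow> 'y) \<Rightarrow> ('x \<Rightarrow>\<^sub>L 'y) set"
  where "bounded_ops s t = {T. \<forall>c x. blinfun_apply T (s c x) = t c (blinfun_apply T x)}"

definition compact_ops ::
  "('k \<Rightarrow> 'x::real_normed_vector \<Rightarrow> 'x) \<Rightarrow> ('k \<Rightarrow> 'y::real_normed_vector \<Rightarrow> 'y) \<Rightarrow> ('x \<Rightarrow>\<^sub>L 'y) set"
  where "compact_ops s t =
    {T \<in> bounded_ops s t. compact (closure (blinfun_apply T ` cball 0 1))}"

definition finite_rank_ops ::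
  "('k::field \<Rightarrow> 'x::real_normed_vector \<Rightarrow> 'x) \<Rightarrow> ('k \<Rightarrow> 'y::real_normed_vector \<Rightarrow> 'y) \<Rightarrow> ('x \<Rightarrow>\<^sub>L 'y) set"
  where "finite_rank_ops s t =
    {T \<in> bounded_ops s t. \<exists>B. finite B \<and> range (blinfun_apply T) \<subseteq> module.span t B}"

definition very_few_operators :: "('k::field \<Rightarrow> 'x::real_normed_vector \<Rightarrow> 'x) \<Rightarrow> bool" where
  "very_few_operators s \<longleftrightarrow> infinite_dim s \<and>
     bounded_ops s s =
       {T. \<exists>c. \<exists>K \<in> compact_ops s s. \<forall>x. blinfun_apply T x = s c x + blinfun_apply K x}"


section \<open>Schauder bases\<close>

definition schauder_basis ::
  "('k \<Rightarrow> 'x::real_normed_vector \<Rightarrow> 'x) \<Rightarrow> (nat \<Rightarrow> 'x) \<Rightarrow> bool" where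
  "schauder_basis s b \<longleftrightarrow> (\<forall>x. \<exists>!a. (\<lambda>n. s (a n) (b n)) sums x)"

text \<open>A basis is shrinking if the norms of the restrictions of any bounded functional to the closed
  linear spans of the tails of the basis tend to 0.\<close>

definition shrinking_basis ::
  "('k::real_normed_field \<Rightarrow> 'x::real_normed_vector \<Rightarrow> 'x) \<Rightarrow> (nat \<Rightarrow> 'x) \<Rightarrow> bool" where
  "shrinking_basis s b \<longleftrightarrow> schauder_basis s b \<and>
     (\<forall>f \<in> bounded_ops s ((*) :: 'k \<Rightarrow> 'k \<Rightarrow> 'k).
        (\<lambda>n. SUP x \<in> closure (module.span s (b ` {n..})) \<inter> cball 0 1. norm (blinfun_apply f x))
          \<longlonglongrightarrow> 0)"


section \<open>Dual spaces isomorphic to \<open>\<ell>\<^sub>1\<close>\<close>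

definition l1 :: "(nat \<Rightarrow> 'k::real_normed_field) set" where
  "l1 = {a. summable (\<lambda>n. norm (a n))}"

definition l1_norm :: "(nat \<Rightarrow> 'k::real_normed_field) \<Rightarrow> real" where
  "l1_norm a = (\<Sum>n. norm (a n))"

text \<open>The scalar multiple of a functional \<open>f\<close> by \<open>c\<close> is the composition of \<open>f\<close> with multiplication
  by \<open>c\<close>.\<close>

definition dual_iso_l1 :: "('k::real_normed_field \<Rightarrow> 'x::real_normed_vector \<Rightarrow> 'x) \<Rightarrow> bool" where
  "dual_iso_l1 s \<longleftrightarrow>
     (let D = bounded_ops s ((*) :: 'k \<Rightarrow> 'k \<Rightarrow> 'k) in
      \<exists>\<Phi> :: ('x \<Rightarrow>\<^sub>L 'k) \<Rightarrow> nat \<Rightarrow> 'k.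
        bij_betw \<Phi> D l1 \<and>
        (\<forall>f\<in>D. \<forall>g\<in>D. \<forall>n. \<Phi> (f + g) n = \<Phi> f n + \<Phi> g n) \<and>
        (\<forall>c. \<forall>f\<in>D. \<forall>n. \<Phi> (blinfun_mult_right c o\<^sub>L f) n = c * \<Phi> f n) \<and>
        (\<exists>m M. 0 < m \<and> (\<forall>f\<in>D. m * norm f \<le> l1_norm (\<Phi> f) \<and> l1_norm (\<Phi> f) \<le> M * norm f)))"


section \<open>The direct sum with the maximum norm\<close>

datatype ('a, 'b) maxsum = MS (ms1: 'a) (ms2: 'b)

instantiation maxsum :: (real_vector, real_vector) real_vector
begin
definition "0 = MS 0 0"
definition "x + y = MS (ms1 x + ms1 y) (ms2 x + ms2 y)"
definition "x - y = MS (ms1 x - ms1 y) (ms2 x - ms2 y)"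
definition "- x = MS (- ms1 x) (- ms2 x)"
definition "r *\<^sub>R x = MS (r *\<^sub>R ms1 x) (r *\<^sub>R ms2 x)"
instance
  by standard
    (simp_all add: zero_maxsum_def plus_maxsum_def minus_maxsum_def uminus_maxsum_def
      scaleR_maxsum_def maxsum.expand algebra_simps)
end

lemmas maxsum_defs = zero_maxsum_def plus_maxsum_def minus_maxsum_def uminus_maxsum_def
  scaleR_maxsum_def

lemma ms_simps [simp]:
  "ms1 0 = 0" "ms2 0 = 0"
  "ms1 (x + y) = ms1 x + ms1 y" "ms2 (x + y) = ms2 x + ms2 y"
  "ms1 (x - y) = ms1 x - ms1 y" "ms2 (x - y) = ms2 x - ms2 y"
  "ms1 (- x) = - ms1 x" "ms2 (- x) = - ms2 x"
  "ms1 (r *\<^sub>R x) = r *\<^sub>R ms1 x" "ms2 (r *\<^sub>R x) = r *\<^sub>R ms2 x"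
  by (simp_all add: maxsum_defs)

instantiation maxsum :: (real_normed_vector, real_normed_vector) real_normed_vector
begin
definition norm_maxsum_def: "norm z = max (norm (ms1 z)) (norm (ms2 z))"
definition sgn_maxsum_def: "sgn (z :: ('a, 'b) maxsum) = inverse (norm z) *\<^sub>R z"
definition dist_maxsum_def: "dist z (w :: ('a, 'b) maxsum) = norm (z - w)"
definition uniformity_maxsum_def [code del]:
  "(uniformity :: (('a, 'b) maxsum \<times> ('a, 'b) maxsum) filter) =
     (INF e\<in>{0<..}. principal {(x, y). dist x y < e})"
definition open_maxsum_def [code del]:
  "open (U :: ('a, 'b) maxsum set) \<longleftrightarrow>
     (\<forall>x\<in>U. eventually (\<lambda>(x', y). x' = x \<longrightarrow> y \<in> U) uniformity)"
instance
proof
  fix z w :: "('a, 'b) maxsum" and r :: real and U :: "('a, 'b) maxsum set"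
  show "(norm z = 0) = (z = 0)"
    using norm_ge_zero[of "ms1 z"] norm_ge_zero[of "ms2 z"]
    by (cases z) (auto simp: norm_maxsum_def zero_maxsum_def max_def)
  show "norm (z + w) \<le> norm z + norm w"
    using norm_triangle_ineq[of "ms1 z" "ms1 w"] norm_triangle_ineq[of "ms2 z" "ms2 w"]
    by (auto simp: norm_maxsum_def max_def)
  show "norm (r *\<^sub>R z) = \<bar>r\<bar> * norm z"
    by (simp add: norm_maxsum_def max_mult_distrib_left)
qed (rule sgn_maxsum_def dist_maxsum_def uniformity_maxsum_def open_maxsum_def)+
end

instance maxsum :: (banach, banach) banach
proof
  fix Z :: "nat \<Rightarrow> ('a, 'b) maxsum"
  assume C: "Cauchy Z"
  have le: "dist (ms1 x) (ms1 y) \<le> dist x y" "dist (ms2 x) (ms2 y) \<le> dist x y"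
    for x y :: "('a, 'b) maxsum"
    by (simp_all add: dist_norm norm_maxsum_def)
  have "Cauchy (\<lambda>n. ms1 (Z n))" "Cauchy (\<lambda>n. ms2 (Z n))"
    using C le unfolding Cauchy_def by (meson le_less_trans)+
  then obtain a b where a: "(\<lambda>n. ms1 (Z n)) \<longlonglongrightarrow> a" and b: "(\<lambda>n. ms2 (Z n)) \<longlonglongrightarrow> b"
    by (auto simp: Cauchy_convergent_iff convergent_def)
  have "(\<lambda>n. max (dist (ms1 (Z n)) a) (dist (ms2 (Z n)) b)) \<longlonglongrightarrow> max 0 0"
    using a b by (intro tendsto_max) (simp_all add: tendsto_dist_iff[symmetric])
  then have "Z \<longlonglongrightarrow> MS a b"
    by (subst tendsto_dist_iff) (simp add: dist_norm norm_maxsum_def)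
  then show "convergent Z"
    by (auto simp: convergent_def)
qed

definition ms_scale ::
  "('k \<Rightarrow> 'x \<Rightarrow> 'x) \<Rightarrow> ('k \<Rightarrow> 'y \<Rightarrow> 'y) \<Rightarrow> 'k \<Rightarrow> ('x, 'y) maxsum \<Rightarrow> ('x, 'y) maxsum" where
  "ms_scale s t c z = MS (s c (ms1 z)) (t c (ms2 z))"

lemma kbanach_ms_scale:
  assumes "kbanach s" and "kbanach t"
  shows "kbanach (ms_scale s t)"
proof -
  interpret s: kbanach s by fact
  interpret t: kbanach t by fact
  show ?thesis
    by unfold_locales
      (simp_all add: ms_scale_def maxsum_defs norm_maxsum_def s.scale_of_real t.scale_of_real
        s.norm_scale t.norm_scale max_mult_distrib_left s.scale_right_distrib t.scale_right_distrib
        s.scale_left_distrib t.scale_left_distrib)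
qed


section \<open>The operator algebra, its closed ideals and the inessential operators\<close>

definition op_ring ::
  "('k \<Rightarrow> 'x::real_normed_vector \<Rightarrow> 'x) \<Rightarrow> ('x \<Rightarrow>\<^sub>L 'x) ring" where
  "op_ring s = \<lparr>carrier = bounded_ops s s, mult = (o\<^sub>L), one = id_blinfun, zero = 0, add = (+)\<rparr>"

lemma ring_op_ring:
  assumes "kbanach s"
  shows "ring (op_ring s)"
proof -
  interpret kbanach s by fact
  have neg: "\<exists>T'\<in>bounded_ops s s. T' + T = 0" if "T \<in> bounded_ops s s" for T
    using that by (intro bexI[of _ "- T"]) (auto simp: bounded_ops_def blinfun.minus_left)
  have "abelian_group (op_ring s)"
    by (rule abelian_groupI)
      (use neg in \<open>auto simp: op_ring_def bounded_ops_def blinfun.add_left scale_right_distrib\<close>)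
  moreover have "monoid (op_ring s)"
    by (rule monoidI) (auto simp: op_ring_def bounded_ops_def intro: blinfun_eqI)
  ultimately show ?thesis
    by (rule ringI)
      (auto simp: op_ring_def blinfun.add_left blinfun.add_right intro: blinfun_eqI)
qed

text \<open>An ideal of the ring is automatically closed under scalar multiplication, as the algebra is
  unital. The operators that are linear over \<open>'k\<close> form a closed set, so an ideal is closed
  relative to the algebra iff it is closed.\<close>

definition closed_ideals ::
  "('k \<Rightarrow> 'x::real_normed_vector \<Rightarrow> 'x) \<Rightarrow> ('x \<Rightarrow>\<^sub>L 'x) set set" where
  "closed_ideals s = {I. ideal I (op_ring s) \<and> closed I}"

definition left_ideal :: "'a set \<Rightarrow> ('a, 'b) ring_scheme \<Rightarrow> bool" where
  "left_ideal I R \<longleftrightarrow> additive_subgroup I R \<and> (\<forall>a\<in>carrier R. \<forall>x\<in>I. a \<otimes>\<^bsub>R\<^esub> x \<in> I)"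

definition maximal_left_ideal :: "'a set \<Rightarrow> ('a, 'b) ring_scheme \<Rightarrow> bool" where
  "maximal_left_ideal M R \<longleftrightarrow> left_ideal M R \<and> M \<noteq> carrier R \<and>
     (\<forall>N. left_ideal N R \<longrightarrow> M \<subseteq> N \<longrightarrow> N = M \<or> N = carrier R)"

definition jacobson_radical :: "('a, 'b) ring_scheme \<Rightarrow> 'a set" where
  "jacobson_radical R = carrier R \<inter> \<Inter>{M. maximal_left_ideal M R}"

definition inessential_ops ::
  "('k::field \<Rightarrow> 'x::real_normed_vector \<Rightarrow> 'x) \<Rightarrow> ('x \<Rightarrow>\<^sub>L 'x) set" where
  "inessential_ops s =
     (let A = closure (finite_rank_ops s s) in
      {T \<in> bounded_ops s s. A +>\<^bsub>op_ring s\<^esub> T \<in> jacobson_radical (op_ring s Quot A)})"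


section \<open>Operator matrices\<close>

definition matrix_rep ::
  "('k \<Rightarrow> 'x::real_normed_vector \<Rightarrow> 'x) \<Rightarrow> ('k \<Rightarrow> 'y::real_normed_vector \<Rightarrow> 'y) \<Rightarrow> ('y \<Rightarrow>\<^sub>L 'x) \<Rightarrow>
   (('x, 'y) maxsum \<Rightarrow>\<^sub>L ('x, 'y) maxsum) \<Rightarrow> 'k \<Rightarrow> 'k \<Rightarrow> 'k \<Rightarrow> bool" where
  "matrix_rep s t J T a11 a12 a22 \<longleftrightarrow>
     (\<exists>K11 \<in> compact_ops s s. \<exists>K12 \<in> compact_ops t s.
      \<exists>K21 \<in> compact_ops s t. \<exists>K22 \<in> compact_ops t t.
        \<forall>x y. blinfun_apply T (MS x y) =
          MS ((s a11 x + blinfun_apply K11 x) + (s a12 (blinfun_apply J y) + blinfun_apply K12 y))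
             (blinfun_apply K21 x + (t a22 y + blinfun_apply K22 y)))"

definition alpha11 ::
  "('k \<Rightarrow> 'x::real_normed_vector \<Rightarrow> 'x) \<Rightarrow> ('k \<Rightarrow> 'y::real_normed_vector \<Rightarrow> 'y) \<Rightarrow> ('y \<Rightarrow>\<^sub>L 'x) \<Rightarrow>
   (('x, 'y) maxsum \<Rightarrow>\<^sub>L ('x, 'y) maxsum) \<Rightarrow> 'k" where
  "alpha11 s t J T = (THE a11. \<exists>a12 a22. matrix_rep s t J T a11 a12 a22)"

definition alpha22 ::
  "('k \<Rightarrow> 'x::real_normed_vector \<Rightarrow> 'x) \<Rightarrow> ('k \<Rightarrow> 'y::real_normed_vector \<Rightarrow> 'y) \<Rightarrow> ('y \<Rightarrow>\<^sub>L 'x) \<Rightarrow>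
   (('x, 'y) maxsum \<Rightarrow>\<^sub>L ('x, 'y) maxsum) \<Rightarrow> 'k" where
  "alpha22 s t J T = (THE a22. \<exists>a11 a12. matrix_rep s t J T a11 a12 a22)"

definition M1 ::
  "('k::field \<Rightarrow> 'x::real_normed_vector \<Rightarrow> 'x) \<Rightarrow> ('k \<Rightarrow> 'y::real_normed_vector \<Rightarrow> 'y) \<Rightarrow>
   ('y \<Rightarrow>\<^sub>L 'x) \<Rightarrow> (('x, 'y) maxsum \<Rightarrow>\<^sub>L ('x, 'y) maxsum) set" where
  "M1 s t J = {T \<in> bounded_ops (ms_scale s t) (ms_scale s t). alpha22 s t J T = 0}"

definition M2 ::
  "('k::field \<Rightarrow> 'x::real_normed_vector \<Rightarrow> 'x) \<Rightarrow> ('k \<Rightarrow> 'y::real_normed_vector \<Rightarrow> 'y) \<Rightarrow>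
   ('y \<Rightarrow>\<^sub>L 'x) \<Rightarrow> (('x, 'y) maxsum \<Rightarrow>\<^sub>L ('x, 'y) maxsum) set" where
  "M2 s t J = {T \<in> bounded_ops (ms_scale s t) (ms_scale s t). alpha11 s t J T = 0}"

end

theory Submission
  imports Defs
begin

text \<open>
  Modulo the compact operators \<open>\<B>(Z)\<close> is the algebra of upper triangular \<open>2 \<times> 2\<close> matrices: the
  entries on and above the diagonal are scalar by hypothesis, and the entry \<open>T: X \<rightarrow> Y\<close> is compact
  because \<open>J T = c I + K\<close> with \<open>c \<noteq> 0\<close> would make the quotient map \<open>X \<rightarrow> X/Y\<close> compact, although \<open>Y\<close>
  has infinite codimension. The matrix algebra has the five ideals spanned by the sets of matrix units
  \<open>{}\<close>, \<open>{e\<^sub>1\<^sub>2}\<close>, \<open>{e\<^sub>1\<^sub>1, e\<^sub>1\<^sub>2}\<close>, \<open>{e\<^sub>1\<^sub>2, e\<^sub>2\<^sub>2}\<close>, \<open>{e\<^sub>1\<^sub>1, e\<^sub>1\<^sub>2, e\<^sub>2\<^sub>2}\<close>, and its radical is spanned by \<open>e\<^sub>1\<^sub>2\<close>. It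
  remains to see that every nonzero closed ideal contains all compact operators. This follows from the
  bounded approximation property of \<open>Z\<close>: the basis projections of \<open>X\<close> are uniformly bounded by a
  Baire category argument, and they leave \<open>Y\<close> invariant.
\<close>

section \<open>Schauder bases\<close>

text \<open>\<open>Y\<close> is a Banach space type of its own, tied to \<open>X\<close> by the
  isometry \<open>J\<close>. What is needed about operators into \<open>Y\<close> is obtained by
  composing with \<open>J\<close>: compactness pulls back along an isometry, and an operator with
  values in the range of \<open>J\<close> lifts without loss of norm. Compactness is handled through
  finite nets, so \<open>X/Y\<close> is never formed: Riesz's lemma is proved relative to a closed
  subspace. The bounded approximation property does three things. It identifies the closure of the
  finite-rank operators with the compact ones, so the inessential operators can be computed in the
  Calkin algebra; it takes a closed ideal from the finite-rank operators to the compact ones; and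
  its operators, being sums of rank-one operators, supply functionals that separate points, which
  puts the finite-rank operators into every nonzero ideal. The inessential operators are bounded
  from both sides. Left multiples of an element of \<open>M1 \<inter> M2\<close> have compact
  squares, which puts the element into the radical; and \<open>M1\<close>, \<open>M2\<close> give
  maximal left ideals of the Calkin algebra, since every operator is a scalar modulo each of
  them.\<close>

text \<open>Zabreiko's lemma: by Baire, some sublevel set of \<open>p\<close> is dense in a ball, and a point of a ball
  around 0 is then exhausted by a series whose \<open>p\<close>-values decay geometrically.\<close>

lemma countably_subadditive_imp_bounded:
  fixes p :: "'a::banach \<Rightarrow> real"
  assumes nonneg: "\<And>x. 0 \<le> p x"
    and homogeneous: "\<And>r x. p (r *\<^sub>R x) = \<bar>r\<bar> * p x"
    and subadd: "\<And>f x. f sums x \<Longrightarrow> summable (\<lambda>n. p (f n)) \<Longrightarrow> p x \<le> (\<Sum>n. p (f n))"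
  obtains C where "0 \<le> C" "\<And>x. p x \<le> C * norm x"
proof -
  have p0: "p 0 = 0"
    using homogeneous[of 0 0] by simp
  have add: "p (x + y) \<le> p x + p y" for x y
  proof -
    define f where "f n = (if n = 0 then x else if n = 1 then y else 0)" for n :: nat
    have "f sums (\<Sum>n\<in>{0,1}. f n)"
      by (rule sums_finite) (auto simp: f_def)
    then have "f sums (x + y)"
      by (simp add: f_def)
    moreover have *: "(\<lambda>n. p (f n)) sums (\<Sum>n\<in>{0,1}. p (f n))"
      by (rule sums_finite) (auto simp: f_def p0)
    ultimately show ?thesis
      using subadd[of f "x + y"] sums_unique[OF *] sums_summable[OF *] by (simp add: f_def)
  qed
  have diff: "p (x - y) \<le> p x + p y" for x y
    using add[of x "- y"] homogeneous[of "-1" y] by simp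
  define A where "A m = closure {x. p x \<le> real m}" for m
  have "(\<Union>(range A)) = UNIV"
  proof -
    have "x \<in> A (nat \<lceil>p x\<rceil>)" for x
      unfolding A_def by (rule subsetD[OF closure_subset]) (simp add: real_nat_ceiling_ge)
    then show ?thesis
      by blast
  qed
  then have "euclidean interior_of (\<Union>(range A)) \<noteq> {}"
    by simp
  then obtain m where m: "interior (A m) \<noteq> {}"
    using Baire_category_alt[OF disjI1[OF completely_metrizable_space_euclidean], of "range A"]
    by (auto simp: A_def closed_closedin[symmetric])
  then obtain x0 r where r: "0 < r" "ball x0 r \<subseteq> A m"
    by (metis all_not_in_conv mem_interior)
  \<comment> \<open>Differences of two points of the sublevel set approximate the vectors of norm
    below \<open>r\<close> with \<open>p\<close>-values at most \<open>2 * real m\<close>. The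
    \<open>+ 1\<close> keeps \<open>D\<close> positive even for \<open>m = 0\<close>.\<close>
  define D where "D = (2 * real m + 1) / r"
  have D: "0 < D"
    using r by (simp add: D_def)
  have approx1: "\<exists>u. p u \<le> 2 * real m + 1 \<and> norm (y - u) < e" if "norm y < r" "0 < e" for y e
  proof -
    have "x0 + y \<in> A m" "x0 \<in> A m"
      using r that by (auto simp: dist_norm subset_iff)
    then obtain u v where "p u \<le> m" "dist u (x0 + y) < e / 2" "p v \<le> m" "dist v x0 < e / 2"
      using \<open>0 < e\<close> unfolding A_def closure_approachable
      by (metis half_gt_zero mem_Collect_eq)
    moreover have "norm (y - (u - v)) \<le> dist u (x0 + y) + dist v x0"
      unfolding dist_norm
      using norm_triangle_ineq4[of "v - x0" "u - (x0 + y)"] by (simp add: algebra_simps)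
    ultimately show ?thesis
      using diff[of u v] by (intro exI[of _ "u - v"]) linarith
  qed
  have approx: "\<exists>u. p u \<le> D * t \<and> norm (y - u) < e" if "norm y < t" "0 < e" for y t e
  proof -
    have t: "0 < t"
      using that norm_ge_zero[of y] by linarith
    have "norm ((r / t) *\<^sub>R y) < r"
      using t r that by (simp add: field_simps)
    moreover have "0 < (r / t) * e"
      using t r that by simp
    ultimately obtain u where u: "p u \<le> 2 * real m + 1" "norm ((r / t) *\<^sub>R y - u) < (r / t) * e"
      using approx1 by blast
    have "(r / t) *\<^sub>R (y - (t / r) *\<^sub>R u) = (r / t) *\<^sub>R y - u"
      using t r by (simp add: algebra_simps)
    then have "norm (y - (t / r) *\<^sub>R u) < e"
      using u(2) t r by (metis abs_of_pos divide_pos_pos mult_less_cancel_left_pos norm_scaleR)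
    moreover have "p ((t / r) *\<^sub>R u) \<le> D * t"
      using mult_left_mono[OF u(1), of "t / r"] t r by (simp add: homogeneous D_def field_simps)
    ultimately show ?thesis
      using t r by (intro exI[of _ "(t / r) *\<^sub>R u"]) simp
  qed
  \<comment> \<open>\<open>U n y\<close> halves the admissible error. Feeding the remainder back in,
    as \<open>Y\<close> does below, keeps the n-th remainder below \<open>(1/2)^n\<close> and the
    \<open>p\<close>-value of the n-th term below a geometric series.\<close>
  define U where
    "U n y = (SOME u. p u \<le> D * (1/2)^n \<and> norm (y - u) < (1/2)^Suc n)" for n :: nat and y
  have U: "p (U n y) \<le> D * (1/2)^n \<and> norm (y - U n y) < (1/2)^Suc n" if "norm y < (1/2)^n" for n y
    unfolding U_def by (rule someI_ex, rule approx[OF that]) simp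
  have unit: "p x \<le> 2 * D" if "norm x < 1" for x
  proof -
    define Y where "Y = rec_nat x (\<lambda>n y. y - U n y)"
    have Y: "Y 0 = x" "Y (Suc n) = Y n - U n (Y n)" for n
      by (simp_all add: Y_def)
    have nY: "norm (Y n) < (1/2)^n" for n
      by (induction n) (use that U in \<open>auto simp: Y\<close>)
    have "Y \<longlonglongrightarrow> 0"
    proof (rule Lim_null_comparison)
      show "\<forall>\<^sub>F n in sequentially. norm (Y n) \<le> (1/2)^n"
        using nY by (simp add: less_imp_le)
      show "(\<lambda>n. (1/2)^n :: real) \<longlonglongrightarrow> 0"
        by (rule LIMSEQ_realpow_zero) auto
    qed
    then have "(\<lambda>n. Y n - Y (Suc n)) sums (Y 0 - 0)"
      by (rule telescope_sums')
    then have sums: "(\<lambda>n. U n (Y n)) sums x"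
      by (simp add: Y)
    have geo: "(\<lambda>n. D * (1/2)^n) sums (D * 2)"
      using sums_mult[OF geometric_sums[of "1/2::real"], of D] by simp
    have le: "p (U n (Y n)) \<le> D * (1/2)^n" for n
      using U nY by blast
    have summ: "summable (\<lambda>n. p (U n (Y n)))"
      by (rule summable_comparison_test'[OF sums_summable[OF geo], of 0]) (use le nonneg in auto)
    have "p x \<le> (\<Sum>n. p (U n (Y n)))"
      by (rule subadd[OF sums summ])
    also have "\<dots> \<le> (\<Sum>n. D * (1/2)^n)"
      by (rule suminf_le[OF le summ sums_summable[OF geo]])
    finally show ?thesis
      using sums_unique[OF geo] by simp
  qed
  show thesis
  proof
    \<comment> \<open>The bound \<open>unit\<close> needs norm strictly below 1; rescaling
      \<open>x\<close> to norm 1/2 turns \<open>2 * D\<close> into \<open>4 * D\<close>.\<close>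
    show "0 \<le> 4 * D"
      using D by simp
    show "p x \<le> 4 * D * norm x" for x
    proof (cases "x = 0")
      case False
      have "p ((1 / (2 * norm x)) *\<^sub>R x) \<le> 2 * D"
        by (rule unit) (use False in simp)
      then show ?thesis
        using False by (simp add: homogeneous field_simps)
    qed (simp add: p0)
  qed
qed

lemma bounded_opsI:
  "(\<And>c x. blinfun_apply T (s c x) = t c (blinfun_apply T x)) \<Longrightarrow> T \<in> bounded_ops s t"
  by (simp add: bounded_ops_def)

lemma bounded_opsD: "T \<in> bounded_ops s t \<Longrightarrow> blinfun_apply T (s c x) = t c (blinfun_apply T x)"
  by (simp add: bounded_ops_def)

context kbanach
begin

lemma bounded_linear_scale_left: "bounded_linear (\<lambda>c. scale c x)"
proof (rule bounded_linear_intro)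
  show "scale (r *\<^sub>R c) x = r *\<^sub>R scale c x" for r c
    by (simp add: scaleR_conv_of_real scale_of_real flip: scale_scale)
qed (auto simp: scale_left_distrib norm_scale)

lemma scale_scaleR: "scale c (r *\<^sub>R x) = r *\<^sub>R scale c x"
  by (simp add: mult.commute flip: scale_of_real)

lemma bounded_linear_scale: "bounded_linear (scale c)"
  by (rule bounded_linear_intro[of _ "norm c"])
    (auto simp: scale_right_distrib norm_scale scale_scaleR mult.commute)

section \<open>Coefficients and uniformly bounded projections of a Schauder basis\<close>

definition basis_coeff :: "(nat \<Rightarrow> 'x) \<Rightarrow> 'x \<Rightarrow> nat \<Rightarrow> 'k" where
  "basis_coeff b x = (THE a. (\<lambda>n. scale (a n) (b n)) sums x)"

context
  fixes b :: "nat \<Rightarrow> 'x"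
  assumes basis: "schauder_basis scale b"
begin

lemma basis_coeff_sums: "(\<lambda>n. scale (basis_coeff b x n) (b n)) sums x"
  using theI'[of "\<lambda>a. (\<lambda>n. scale (a n) (b n)) sums x"] basis
  by (simp add: schauder_basis_def basis_coeff_def)

lemma basis_coeff_eqI: "(\<lambda>n. scale (a n) (b n)) sums x \<Longrightarrow> basis_coeff b x = a"
  using basis basis_coeff_sums unfolding schauder_basis_def by blast

lemma basis_coeff_add: "basis_coeff b (x + y) n = basis_coeff b x n + basis_coeff b y n"
proof -
  have "basis_coeff b (x + y) = (\<lambda>n. basis_coeff b x n + basis_coeff b y n)"
    by (rule basis_coeff_eqI)
      (use sums_add[OF basis_coeff_sums basis_coeff_sums] in \<open>simp add: scale_left_distrib\<close>)
  then show ?thesis by simp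
qed

lemma basis_coeff_scale: "basis_coeff b (scale c x) n = c * basis_coeff b x n"
proof -
  have "basis_coeff b (scale c x) = (\<lambda>n. c * basis_coeff b x n)"
    by (rule basis_coeff_eqI)
      (use bounded_linear.sums[OF bounded_linear_scale basis_coeff_sums] in simp)
  then show ?thesis by simp
qed

lemma basis_coeff_basis: "basis_coeff b (b k) = (\<lambda>n. if n = k then 1 else 0)"
proof (rule basis_coeff_eqI)
  have "(\<lambda>n. scale (if n = k then 1 else 0) (b n)) sums
      (\<Sum>n\<in>{k}. scale (if n = k then 1 else 0) (b n))"
    by (rule sums_finite) auto
  then show "(\<lambda>n. scale (if n = k then 1 else 0) (b n)) sums b k"
    by simp
qed

lemma schauder_basis_nonzero: "b k \<noteq> 0"
proof
  assume "b k = 0"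
  then have "basis_coeff b (b k) = (\<lambda>n. 0)"
    by (intro basis_coeff_eqI) simp
  then show False
    by (simp add: basis_coeff_basis) (metis zero_neq_one)
qed

definition partial_sum :: "nat \<Rightarrow> 'x \<Rightarrow> 'x" where
  "partial_sum n x = (\<Sum>k<n. scale (basis_coeff b x k) (b k))"

lemma partial_sum_tendsto: "(\<lambda>n. partial_sum n x) \<longlonglongrightarrow> x"
  using basis_coeff_sums by (simp add: sums_def partial_sum_def)

lemma partial_sum_add: "partial_sum n (x + y) = partial_sum n x + partial_sum n y"
  by (simp add: partial_sum_def basis_coeff_add scale_left_distrib sum.distrib)

lemma partial_sum_scale: "partial_sum n (scale c x) = scale c (partial_sum n x)"
  by (simp add: partial_sum_def basis_coeff_scale scale_sum_right)

lemma bdd_partial_sum: "bdd_above (range (\<lambda>n. norm (partial_sum n x)))"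
proof -
  have "Bseq (\<lambda>n. partial_sum n x)"
    using partial_sum_tendsto by (meson Bseq_conv_Bfun convergentI convergent_imp_Bseq)
  then show ?thesis
    by (auto simp: Bseq_def bdd_above_def)
qed

text \<open>The classical renorming that makes the basis projections contractive. Bounding it by a
  multiple of the given norm is the same as bounding the projections uniformly.\<close>

definition basis_norm :: "'x \<Rightarrow> real" where
  "basis_norm x = (SUP n. norm (partial_sum n x))"

lemma norm_partial_sum_le: "norm (partial_sum n x) \<le> basis_norm x"
  unfolding basis_norm_def by (rule cSUP_upper[OF _ bdd_partial_sum]) simp

text \<open>The n-th term of the expansion is a difference of consecutive partial sums. At this
  point the coefficients are controlled by \<open>basis_norm\<close> only, which is enough to sum
  them over a series with summable \<open>basis_norm\<close>.\<close>

lemma norm_basis_coeff_le: "norm (basis_coeff b x n) \<le> 2 / norm (b n) * basis_norm x"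
proof -
  have "scale (basis_coeff b x n) (b n) = partial_sum (Suc n) x - partial_sum n x"
    by (simp add: partial_sum_def)
  then have "norm (basis_coeff b x n) * norm (b n) \<le> 2 * basis_norm x"
    using norm_triangle_ineq4[of "partial_sum (Suc n) x" "partial_sum n x"]
      norm_partial_sum_le[of "Suc n" x] norm_partial_sum_le[of n x]
    by (simp flip: norm_scale)
  then show ?thesis
    using schauder_basis_nonzero[of n] by (simp add: field_simps)
qed

text \<open>Adding up the coefficients of the \<open>f k\<close> gives an expansion of \<open>x\<close>, which by uniqueness is the
  basis expansion.\<close>

lemma basis_norm_countably_subadditive:
  assumes f: "f sums x" and summ: "summable (\<lambda>k. basis_norm (f k))"
  shows "basis_norm x \<le> (\<Sum>k. basis_norm (f k))"
proof -
  define c where "c n = (\<Sum>k. basis_coeff b (f k) n)" for n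
  have "summable (\<lambda>k. basis_coeff b (f k) n)" for n
    by (rule summable_comparison_test'[OF summable_mult[OF summ]]) (rule norm_basis_coeff_le)
  then have c: "(\<lambda>k. scale (basis_coeff b (f k) n) (b n)) sums scale (c n) (b n)" for n
    unfolding c_def by (intro bounded_linear.sums[OF bounded_linear_scale_left] summable_sums)
  have S: "(\<lambda>k. partial_sum n (f k)) sums (\<Sum>j<n. scale (c j) (b j))" for n
    unfolding partial_sum_def by (rule sums_sum) (rule c)
  \<comment> \<open>The majorant does not depend on the length \<open>n\<close> of the partial sums,
    so the limit in \<open>n\<close> and the sum over \<open>k\<close> may be exchanged. This
    identifies \<open>x\<close> as the limit of the expansion with coefficients
    \<open>c\<close>.\<close>
  have unif: "uniform_limit UNIV (\<lambda>m n. \<Sum>k<m. partial_sum n (f k))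
      (\<lambda>n. \<Sum>k. partial_sum n (f k)) sequentially"
    by (rule Weierstrass_m_test[OF _ summ]) (rule norm_partial_sum_le)
  have "(\<lambda>n. \<Sum>k. partial_sum n (f k)) \<longlonglongrightarrow> x"
    by (rule swap_uniform_limit'[OF _ _ unif])
      (use f in \<open>auto simp: sums_def intro!: always_eventually tendsto_sum partial_sum_tendsto\<close>)
  then have "basis_coeff b x = c"
    using S[THEN sums_unique] by (intro basis_coeff_eqI) (simp add: sums_def)
  then have "partial_sum n x = (\<Sum>k. partial_sum n (f k))" for n
    using S[THEN sums_unique] by (simp add: partial_sum_def)
  moreover have "norm (\<Sum>k. partial_sum n (f k)) \<le> (\<Sum>k. basis_norm (f k))" for n
    by (rule norm_suminf_le[OF _ summ]) (rule norm_partial_sum_le)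
  ultimately show ?thesis
    unfolding basis_norm_def[of x] by (intro cSUP_least) auto
qed

text \<open>\<open>P n\<close> is \<open>partial_sum n\<close>. Since \<open>basis_norm\<close>
  dominates all partial sums at once, the single constant that Zabreiko's lemma gives for it bounds
  every projection.\<close>

lemma schauder_basis_projections:
  obtains P C where
    "\<And>n. P n \<in> bounded_ops scale scale"
    "\<And>n. norm (P n) \<le> C"
    "\<And>x. (\<lambda>n. blinfun_apply (P n) x) \<longlonglongrightarrow> x"
    "\<And>n. range (blinfun_apply (P n)) \<subseteq> span (b ` {..<n})"
    "\<And>n k. blinfun_apply (P n) (b k) = (if k < n then b k else 0)"
proof -
  have nonneg: "0 \<le> basis_norm x" for x
    using norm_partial_sum_le[of 0 x] by (simp add: partial_sum_def)
  have scaleR: "partial_sum n (r *\<^sub>R x) = r *\<^sub>R partial_sum n x" for n r x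
    by (simp add: partial_sum_scale flip: scale_of_real)
  have le: "basis_norm (r *\<^sub>R x) \<le> \<bar>r\<bar> * basis_norm x" for r x
    unfolding basis_norm_def[of "r *\<^sub>R x"]
    by (rule cSUP_least) (auto simp: scaleR intro!: mult_left_mono norm_partial_sum_le)
  have hom: "basis_norm (r *\<^sub>R x) = \<bar>r\<bar> * basis_norm x" for r x
  proof (cases "r = 0")
    case True
    then show ?thesis
      using le[of 0 x] nonneg[of 0] by simp
  next
    case False
    then show ?thesis
      using le[of r x] le[of "inverse r" "r *\<^sub>R x"] by (simp add: field_simps)
  qed
  obtain C where C: "0 \<le> C" "\<And>x. basis_norm x \<le> C * norm x"
    using countably_subadditive_imp_bounded[OF nonneg hom basis_norm_countably_subadditive]
    by blast
  have bl: "bounded_linear (partial_sum n)" for n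
  proof (rule bounded_linear_intro[of _ C])
    show "partial_sum n (r *\<^sub>R x) = r *\<^sub>R partial_sum n x" for r x
      by (rule scaleR)
    show "norm (partial_sum n x) \<le> norm x * C" for x
      using norm_partial_sum_le[of n x] C(2)[of x] by (simp add: mult.commute)
  qed (rule partial_sum_add)
  note [simp] = bounded_linear_Blinfun_apply[OF bl]
  show thesis
  proof (rule that[of "\<lambda>n. Blinfun (partial_sum n)" C])
    show "Blinfun (partial_sum n) \<in> bounded_ops scale scale" for n
      by (rule bounded_opsI) (simp add: partial_sum_scale)
    show "norm (Blinfun (partial_sum n)) \<le> C" for n
      by (rule norm_blinfun_bound[OF C(1)])
        (simp add: order_trans[OF norm_partial_sum_le C(2)])
    show "(\<lambda>n. blinfun_apply (Blinfun (partial_sum n)) x) \<longlonglongrightarrow> x" for x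
      by (simp add: partial_sum_tendsto)
    show "range (blinfun_apply (Blinfun (partial_sum n))) \<subseteq> span (b ` {..<n})" for n
    proof -
      have "partial_sum n x \<in> span (b ` {..<n})" for x
        unfolding partial_sum_def by (intro span_sum span_scale span_base) simp
      then show ?thesis
        by auto
    qed
    show "blinfun_apply (Blinfun (partial_sum n)) (b k) = (if k < n then b k else 0)" for n k
    proof -
      have "partial_sum n (b k) = (\<Sum>j<n. if j = k then b k else 0)"
        unfolding partial_sum_def by (rule sum.cong) (auto simp: basis_coeff_basis)
      then show ?thesis by simp
    qed
  qed
qed

end

end

section \<open>Total boundedness and finite-dimensional subspaces\<close>

lemma totally_bounded_iff_dist:
  fixes S :: "'a::metric_space set"
  shows "totally_bounded S \<longleftrightarrow> (\<forall>e>0. \<exists>F. finite F \<and> (\<forall>x\<in>S. \<exists>y\<in>F. dist y x < e))"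
  unfolding totally_bounded_metric by (simp add: subset_iff Ball_def)

lemma totally_bounded_approx:
  fixes S :: "'a::metric_space set"
  assumes "\<And>e. 0 < e \<Longrightarrow> \<exists>A. totally_bounded A \<and> (\<forall>x\<in>S. \<exists>a\<in>A. dist a x < e)"
  shows "totally_bounded S"
  unfolding totally_bounded_iff_dist
proof (intro allI impI)
  fix e :: real assume "0 < e"
  then obtain A where A: "totally_bounded A" "\<And>x. x \<in> S \<Longrightarrow> \<exists>a\<in>A. dist a x < e / 2"
    using assms[of "e / 2"] by auto
  from A(1) \<open>0 < e\<close> obtain F where F: "finite F" "\<And>a. a \<in> A \<Longrightarrow> \<exists>y\<in>F. dist y a < e / 2"
    unfolding totally_bounded_iff_dist by (meson half_gt_zero)
  have "\<exists>y\<in>F. dist y x < e" if "x \<in> S" for x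
    using A(2)[OF that] F(2) dist_triangle_half_r by (metis dist_commute)
  then show "\<exists>F. finite F \<and> (\<forall>x\<in>S. \<exists>y\<in>F. dist y x < e)"
    using F(1) by blast
qed

text \<open>Turns compactness of an operator into the existence of finite nets for the image of the
  unit ball.\<close>

lemma compact_closure_iff_totally_bounded:
  fixes S :: "'a::complete_space set"
  shows "compact (closure S) \<longleftrightarrow> totally_bounded S"
proof
  assume "compact (closure S)"
  then have "totally_bounded (closure S)"
    unfolding compact_eq_totally_bounded totally_bounded_metric ball_def by simp
  then show "totally_bounded S"
    using closure_subset totally_bounded_subset by blast
next
  assume S: "totally_bounded S"
  have "totally_bounded (closure S)"
  proof (rule totally_bounded_approx)
    fix e :: real assume "0 < e"
    then show "\<exists>A. totally_bounded A \<and> (\<forall>x\<in>closure S. \<exists>a\<in>A. dist a x < e)"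
      using S by (auto simp: closure_approachable)
  qed
  then show "compact (closure S)"
    by (simp add: compact_eq_totally_bounded totally_bounded_metric ball_def complete_eq_closed)
qed

lemma bounded_imp_totally_bounded:
  fixes S :: "'a::heine_borel set"
  shows "bounded S \<Longrightarrow> totally_bounded S"
  by (simp flip: compact_closure_iff_totally_bounded)

lemma totally_bounded_linear_image:
  assumes T: "bounded_linear T" and S: "totally_bounded S"
  shows "totally_bounded (T ` S)"
  unfolding totally_bounded_iff_dist
proof (intro allI impI)
  fix e :: real assume "0 < e"
  obtain B where B: "0 < B" "\<And>x. norm (T x) \<le> norm x * B"
    using bounded_linear.pos_bounded[OF T] by blast
  obtain F where F: "finite F" "\<And>x. x \<in> S \<Longrightarrow> \<exists>y\<in>F. dist y x < e / B"
    using S \<open>0 < e\<close> B(1) unfolding totally_bounded_iff_dist by (meson divide_pos_pos)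
  have "dist (T y) (T x) < e" if "dist y x < e / B" for x y
  proof -
    have "dist (T y) (T x) \<le> dist y x * B"
      using B(2)[of "y - x"] by (simp add: dist_norm linear_diff[OF bounded_linear.linear[OF T]])
    also have "\<dots> < e"
      using that B(1) by (simp add: field_simps)
    finally show ?thesis .
  qed
  then show "\<exists>F. finite F \<and> (\<forall>x\<in>T ` S. \<exists>y\<in>F. dist y x < e)"
    using F by (intro exI[of _ "T ` F"]) fastforce
qed

lemma totally_bounded_plus:
  fixes A B :: "'a::real_normed_vector set"
  assumes A: "totally_bounded A" and B: "totally_bounded B"
  shows "totally_bounded {a + b |a b. a \<in> A \<and> b \<in> B}"
  unfolding totally_bounded_iff_dist
proof (intro allI impI)
  fix e :: real assume "0 < e"
  then have e: "0 < e / 2" by simp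
  obtain F where F: "finite F" "\<And>x. x \<in> A \<Longrightarrow> \<exists>y\<in>F. dist y x < e / 2"
    using A e unfolding totally_bounded_iff_dist by meson
  obtain G where G: "finite G" "\<And>x. x \<in> B \<Longrightarrow> \<exists>y\<in>G. dist y x < e / 2"
    using B e unfolding totally_bounded_iff_dist by meson
  have "\<exists>y\<in>(\<lambda>(u, v). u + v) ` (F \<times> G). dist y (a + b) < e" if "a \<in> A" "b \<in> B" for a b
  proof -
    obtain u where "u \<in> F" "dist u a < e / 2"
      using F(2)[OF \<open>a \<in> A\<close>] by auto
    moreover obtain v where "v \<in> G" "dist v b < e / 2"
      using G(2)[OF \<open>b \<in> B\<close>] by auto
    ultimately show ?thesis
      using dist_triangle_add[of u v a b] by (intro bexI[of _ "u + v"]) auto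
  qed
  then show "\<exists>F. finite F \<and> (\<forall>x\<in>{a + b |a b. a \<in> A \<and> b \<in> B}. \<exists>y\<in>F. dist y x < e)"
    using F(1) G(1) by (intro exI[of _ "(\<lambda>(u, v). u + v) ` (F \<times> G)"]) auto
qed

context kbanach
begin

text \<open>\<open>d\<close> is the distance of \<open>v\<close> from \<open>S\<close>; dividing by
  \<open>c\<close> reduces the claim to that distance. The bound says that the coefficient of
  \<open>v\<close> modulo \<open>S\<close> depends continuously on the vector, which drives the
  inductions over spanning sets.\<close>

lemma dist_subspace_bound:
  assumes S: "subspace S" "closed S" and v: "v \<notin> S"
  obtains d where "0 < d" "\<And>s c. s \<in> S \<Longrightarrow> norm c * d \<le> norm (s + scale c v)"
proof
  show "0 < infdist v S"
    using S v by (intro infdist_pos_not_in_closed) (auto dest: subspace_0)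
  fix s c assume s: "s \<in> S"
  show "norm c * infdist v S \<le> norm (s + scale c v)"
  proof (cases "c = 0")
    case False
    have "infdist v S \<le> dist v (- scale (inverse c) s)"
      using S s by (intro infdist_le subspace_neg subspace_scale)
    then have "norm c * infdist v S \<le> norm (scale c (v + scale (inverse c) s))"
      by (simp add: dist_norm norm_scale mult_left_mono)
    then show ?thesis
      using False by (simp add: scale_right_distrib add.commute)
  qed simp
qed

text \<open>Along a convergent sequence the coefficients of \<open>v\<close> form a Cauchy sequence,
  by the distance bound. Subtracting their limit times \<open>v\<close> leaves a limit in the closed
  subspace.\<close>

lemma closed_span_insert:
  assumes A: "closed (span A)"
  shows "closed (span (insert v A))"
proof (cases "v \<in> span A")
  case True
  then show ?thesis
    using A by (simp add: span_redundant)
next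
  case False
  obtain d where d: "0 < d" "\<And>s c. s \<in> span A \<Longrightarrow> norm c * d \<le> norm (s + scale c v)"
    using dist_subspace_bound[OF subspace_span A False] by blast
  show ?thesis
    unfolding closed_sequential_limits
  proof (intro allI impI, elim conjE)
    fix x l assume x: "\<forall>n. x n \<in> span (insert v A)" and l: "x \<longlonglongrightarrow> l"
    have "\<forall>n. \<exists>c. x n - scale c v \<in> span A"
      using x by (simp add: span_breakdown_eq)
    then obtain c where c: "\<And>n. x n - scale (c n) v \<in> span A"
      by metis
    have le: "norm (c m - c n) * d \<le> norm (x m - x n)" for m n
      using d(2)[OF span_diff[OF c[of m] c[of n]], of "c m - c n"]
      by (simp add: algebra_simps scale_left_diff_distrib)
    have "Cauchy c"
      unfolding Cauchy_def
    proof (intro allI impI)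
      fix e :: real assume "0 < e"
      then obtain M where M: "\<forall>m\<ge>M. \<forall>n\<ge>M. dist (x m) (x n) < e * d"
        using LIMSEQ_imp_Cauchy[OF l] d(1) unfolding Cauchy_def by (meson mult_pos_pos)
      have "dist (c m) (c n) < e" if "M \<le> m" "M \<le> n" for m n
      proof -
        have "norm (c m - c n) * d < e * d"
          using le[of m n] M that by (auto simp: dist_norm intro: le_less_trans)
        then show ?thesis
          using d(1) by (simp add: dist_norm)
      qed
      then show "\<exists>M. \<forall>m\<ge>M. \<forall>n\<ge>M. dist (c m) (c n) < e"
        by blast
    qed
    then obtain c' where "c \<longlonglongrightarrow> c'"
      by (auto simp: Cauchy_convergent_iff convergent_def)
    then have "(\<lambda>n. x n - scale (c n) v) \<longlonglongrightarrow> l - scale c' v"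
      by (intro tendsto_diff l bounded_linear.tendsto[OF bounded_linear_scale_left])
    then have "l - scale c' v \<in> span A"
      using closed_sequentially[OF A, of "\<lambda>n. x n - scale (c n) v"] c by simp
    then show "l \<in> span (insert v A)"
      unfolding span_breakdown_eq by blast
  qed
qed

lemma closed_span_Un_finite:
  assumes "finite B" "closed (span A)"
  shows "closed (span (A \<union> B))"
  using assms by (induction B rule: finite_induct) (auto intro: closed_span_insert)

lemma closed_span_finite: "finite B \<Longrightarrow> closed (span B)"
  using closed_span_Un_finite[of B "{}"] by simp

text \<open>Splits off one vector \<open>v\<close>: its coefficients stay in a bounded set of
  scalars, where Heine-Borel applies, and the remainders form a bounded subset of the smaller
  span.\<close>

lemma totally_bounded_in_finite_span:
  assumes "finite B" "S \<subseteq> span B" "bounded S"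
  shows "totally_bounded S"
  using assms
proof (induction B arbitrary: S rule: finite_induct)
  case empty
  then have "S \<subseteq> {0}" by simp
  then show ?case
    by (rule totally_bounded_subset[rotated]) (simp add: totally_bounded_iff_dist exI[of _ "{0}"])
next
  case (insert v B)
  show ?case
  proof (cases "v \<in> span B")
    case True
    then show ?thesis
      using insert by (simp add: span_redundant)
  next
    case False
    obtain d where d: "0 < d" "\<And>s c. s \<in> span B \<Longrightarrow> norm c * d \<le> norm (s + scale c v)"
      using dist_subspace_bound[OF subspace_span closed_span_finite[OF insert(1)] False] by blast
    obtain M where M: "\<And>x. x \<in> S \<Longrightarrow> norm x \<le> M"
      using insert.prems(2) by (auto simp: bounded_iff)
    \<comment> \<open>\<open>M / d\<close> bounds the coefficient of \<open>v\<close>; the triangle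
      inequality then gives the radius used in \<open>A\<close> for the component in
      \<open>span B\<close>.\<close>
    define L where "L = (\<lambda>c. scale c v) ` cball 0 (M / d)"
    define A where "A = span B \<inter> cball 0 (M + M / d * norm v)"
    have "totally_bounded A"
      by (rule insert.IH) (auto simp: A_def intro: bounded_subset[OF bounded_cball])
    moreover have "totally_bounded L"
      unfolding L_def
      by (intro totally_bounded_linear_image bounded_linear_scale_left
          bounded_imp_totally_bounded bounded_cball)
    moreover have "S \<subseteq> {a + b |a b. a \<in> A \<and> b \<in> L}"
    proof
      fix x assume x: "x \<in> S"
      then have "x \<in> span (insert v B)"
        using insert.prems(1) by blast
      then obtain c where c: "x - scale c v \<in> span B"
        unfolding span_breakdown_eq by blast
      have nc: "norm c \<le> M / d"
        using d(2)[OF c, of c] M[OF x] d(1) by (simp add: field_simps)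
      have "norm (x - scale c v) \<le> norm x + norm c * norm v"
        using norm_triangle_ineq4[of x "scale c v"] by (simp add: norm_scale)
      also have "\<dots> \<le> M + M / d * norm v"
        using nc M[OF x] by (intro add_mono mult_right_mono) auto
      finally have "x - scale c v \<in> A"
        using c by (simp add: A_def)
      moreover have "scale c v \<in> L"
        unfolding L_def using nc by (intro imageI) simp
      ultimately show "x \<in> {a + b |a b. a \<in> A \<and> b \<in> L}"
        using diff_add_cancel[of x "scale c v"] by (smt (verit, best) mem_Collect_eq)
    qed
    ultimately show ?thesis
      by (rule totally_bounded_subset[OF totally_bounded_plus])
  qed
qed

text \<open>Riesz's lemma: a vector of the unit ball far from the span of \<open>S\<close> and a finite net of \<open>A\<close>
  cannot be congruent to an element of \<open>A\<close> modulo \<open>S\<close>.\<close>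

lemma finite_codim_if_ball_totally_bounded:
  assumes S: "subspace S" "closed S" and A: "totally_bounded A"
    and ball: "\<And>x. norm x \<le> 1 \<Longrightarrow> \<exists>a\<in>A. x - a \<in> S"
  shows "\<exists>B. finite B \<and> span (S \<union> B) = UNIV"
proof -
  obtain F where F: "finite F" "\<And>a. a \<in> A \<Longrightarrow> \<exists>y\<in>F. dist y a < 1 / 2"
    using A unfolding totally_bounded_iff_dist by (meson half_gt_zero zero_less_one)
  define W where "W = span (S \<union> F)"
  have W: "subspace W" "closed W"
    unfolding W_def by (auto intro!: closed_span_Un_finite F(1) simp: span_eq_iff[THEN iffD2] S)
  have "v \<in> W" for v
  proof (rule ccontr)
    assume v: "v \<notin> W"
    define d where "d = infdist v W"
    have d: "0 < d"
      unfolding d_def using W v by (intro infdist_pos_not_in_closed) (auto dest: subspace_0)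
    \<comment> \<open>The factor 2 matches the mesh 1/2 of the net \<open>F\<close>: correcting
      \<open>w\<close> by \<open>n *\<^sub>R u\<close> gives a point of \<open>W\<close> within
      \<open>n / 2 < d\<close> of \<open>v\<close>, although \<open>d\<close> is the distance of
      \<open>v\<close> from \<open>W\<close>.\<close>
    have "infdist v W < 2 * d"
      using d by (simp add: d_def)
    then obtain w where w: "w \<in> W" "dist v w < 2 * d"
      using W by (metis all_not_in_conv infdist_notempty cINF_less_iff bdd_below_image_dist subspace_0)
    define n where "n = norm (v - w)"
    have n: "0 < n" "n < 2 * d"
      using w v by (auto simp: n_def dist_norm)
    have "norm ((1 / n) *\<^sub>R (v - w)) \<le> 1"
      using n(1) by (simp add: n_def)
    then obtain a where a: "a \<in> A" "(1 / n) *\<^sub>R (v - w) - a \<in> S"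
      using ball by blast
    obtain f where f: "f \<in> F" "dist f a < 1 / 2"
      using F(2) a(1) by blast
    define u where "u = ((1 / n) *\<^sub>R (v - w) - a) + f"
    have "u \<in> W"
      unfolding u_def W_def using a(2) f(1) by (intro span_add span_base) auto
    then have "w + n *\<^sub>R u \<in> W"
      using W(1) w(1) by (metis scale_of_real subspace_add subspace_scale)
    then have "d \<le> dist v (w + n *\<^sub>R u)"
      unfolding d_def by (rule infdist_le)
    also have "v - (w + n *\<^sub>R u) = n *\<^sub>R (a - f)"
      using n(1) by (simp add: u_def algebra_simps)
    then have "dist v (w + n *\<^sub>R u) = n * dist f a"
      using n(1) by (simp add: dist_norm norm_minus_commute)
    also have "\<dots> < n * (1 / 2)"
      using f(2) n(1) by (intro mult_strict_left_mono)
    finally show False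
      using n(2) by simp
  qed
  then have "W = UNIV"
    by blast
  then show ?thesis
    using F(1) W_def by blast
qed

text \<open>The case \<open>S = {0}\<close> of the preceding lemma, with the ball itself in the role
  of \<open>A\<close>.\<close>

lemma ball_not_totally_bounded:
  assumes "infinite_dim scale"
  shows "\<not> totally_bounded (cball (0::'x) 1)"
proof
  assume "totally_bounded (cball (0::'x) 1)"
  from finite_codim_if_ball_totally_bounded[OF subspace_single_0 _ this]
  obtain B where "finite B" "span ({0} \<union> B) = UNIV"
    by auto
  then show False
    using assms unfolding infinite_dim_def by (metis finite_insert insert_is_Un)
qed

end

section \<open>Compact and finite-rank operators\<close>

lemma bounded_ops_zero: "kbanach t \<Longrightarrow> 0 \<in> bounded_ops s t"
  by (auto intro!: bounded_opsI simp: module.scale_zero_right module_iff_vector_space kbanach_def)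

lemma bounded_ops_add:
  "kbanach t \<Longrightarrow> S \<in> bounded_ops s t \<Longrightarrow> T \<in> bounded_ops s t \<Longrightarrow> S + T \<in> bounded_ops s t"
  unfolding kbanach_def
  by (auto simp: bounded_ops_def blinfun.add_left vector_space.vector_space_assms(1))

lemma bounded_ops_uminus:
  "kbanach t \<Longrightarrow> T \<in> bounded_ops s t \<Longrightarrow> - T \<in> bounded_ops s t"
  by (auto simp: bounded_ops_def blinfun.minus_left module.scale_minus_right
      module_iff_vector_space kbanach_def)

lemma bounded_ops_diff:
  "kbanach t \<Longrightarrow> S \<in> bounded_ops s t \<Longrightarrow> T \<in> bounded_ops s t \<Longrightarrow> S - T \<in> bounded_ops s t"
  using bounded_ops_add[of t S s "- T"] bounded_ops_uminus[of t T s] by simp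

lemma bounded_ops_compose:
  "S \<in> bounded_ops t u \<Longrightarrow> T \<in> bounded_ops s t \<Longrightarrow> S o\<^sub>L T \<in> bounded_ops s u"
  by (simp add: bounded_ops_def)

lemma id_bounded_ops: "id_blinfun \<in> bounded_ops s s"
  by (simp add: bounded_ops_def)

lemma closed_bounded_ops:
  assumes "kbanach t"
  shows "closed (bounded_ops s t)"
proof -
  interpret t: kbanach t by fact
  have "bounded_ops s t = (\<Inter>c x. {T. blinfun_apply T (s c x) = t c (blinfun_apply T x)})"
    by (auto simp: bounded_ops_def)
  moreover have "closed {T. blinfun_apply T (s c x) = t c (blinfun_apply T x)}" for c x
    by (intro closed_Collect_eq bounded_linear.continuous_on[OF t.bounded_linear_scale]
        continuous_intros)
  ultimately show ?thesis
    by (auto intro!: closed_INT)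
qed

lemma compact_ops_iff:
  fixes t :: "'k \<Rightarrow> 'y::banach \<Rightarrow> 'y"
  shows "T \<in> compact_ops s t \<longleftrightarrow>
    T \<in> bounded_ops s t \<and> totally_bounded (blinfun_apply T ` cball 0 1)"
  by (simp add: compact_ops_def compact_closure_iff_totally_bounded)

lemma compact_imp_bounded_op: "T \<in> compact_ops s t \<Longrightarrow> T \<in> bounded_ops s t"
  by (simp add: compact_ops_def)

lemma compact_ops_add:
  fixes t :: "'k::{real_normed_field,euclidean_space} \<Rightarrow> 'y::banach \<Rightarrow> 'y"
  assumes t: "kbanach t" and S: "S \<in> compact_ops s t" and T: "T \<in> compact_ops s t"
  shows "S + T \<in> compact_ops s t"
proof -
  have "totally_bounded (blinfun_apply (S + T) ` cball 0 1)"
    by (rule totally_bounded_subset[OF totally_bounded_plus[of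
          "blinfun_apply S ` cball 0 1" "blinfun_apply T ` cball 0 1"]])
      (use S T in \<open>auto simp: compact_ops_iff blinfun.add_left\<close>)
  then show ?thesis
    using S T bounded_ops_add[OF t] by (auto simp: compact_ops_iff)
qed

lemma compact_ops_compose_left:
  fixes t :: "'k \<Rightarrow> 'y::banach \<Rightarrow> 'y" and u :: "'k \<Rightarrow> 'z::banach \<Rightarrow> 'z"
  assumes T: "T \<in> bounded_ops t u" and K: "K \<in> compact_ops s t"
  shows "T o\<^sub>L K \<in> compact_ops s u"
proof -
  have "totally_bounded (blinfun_apply T ` blinfun_apply K ` cball 0 1)"
    by (rule totally_bounded_linear_image[OF blinfun.bounded_linear_right])
      (use K in \<open>simp add: compact_ops_iff\<close>)
  moreover have "blinfun_apply (T o\<^sub>L K) = blinfun_apply T \<circ> blinfun_apply K"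
    by auto
  ultimately show ?thesis
    using T K bounded_ops_compose by (auto simp: compact_ops_iff image_comp)
qed

lemma compact_ops_compose_right:
  fixes u :: "'k \<Rightarrow> 'z::banach \<Rightarrow> 'z" and s :: "'k \<Rightarrow> 'x::real_normed_vector \<Rightarrow> 'x"
  assumes K: "K \<in> compact_ops t u" and T: "T \<in> bounded_ops s t"
  shows "K o\<^sub>L T \<in> compact_ops s u"
proof -
  \<comment> \<open>The \<open>+ 1\<close> allows division by \<open>r\<close> also when
    \<open>T = 0\<close>.\<close>
  define r where "r = norm T + 1"
  have r: "0 < r"
    by (simp add: r_def add_nonneg_pos)
  have "totally_bounded ((\<lambda>x. r *\<^sub>R x) ` blinfun_apply K ` cball 0 1)"
    by (rule totally_bounded_linear_image[OF bounded_linear_scaleR_right])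
      (use K in \<open>simp add: compact_ops_iff\<close>)
  moreover have "blinfun_apply (K o\<^sub>L T) ` cball 0 1 \<subseteq> (\<lambda>x. r *\<^sub>R x) ` blinfun_apply K ` cball 0 1"
  proof (rule image_subsetI)
    fix x :: 'x assume x: "x \<in> cball 0 1"
    have "norm (blinfun_apply T x) \<le> norm T * 1"
      using norm_blinfun[of T x] x by (meson mem_cball_0 mult_left_mono norm_ge_zero order_trans)
    then have "(1 / r) *\<^sub>R blinfun_apply T x \<in> cball 0 1"
      using r by (simp add: r_def)
    moreover have "blinfun_apply (K o\<^sub>L T) x = r *\<^sub>R blinfun_apply K ((1 / r) *\<^sub>R blinfun_apply T x)"
      using r by (simp add: blinfun.scaleR_right)
    ultimately show "blinfun_apply (K o\<^sub>L T) x \<in> (\<lambda>x. r *\<^sub>R x) ` blinfun_apply K ` cball 0 1"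
      by blast
  qed
  ultimately show ?thesis
    using K T bounded_ops_compose totally_bounded_subset by (auto simp: compact_ops_iff)
qed

lemma closed_compact_ops:
  fixes t :: "'k::{real_normed_field,euclidean_space} \<Rightarrow> 'y::banach \<Rightarrow> 'y"
  assumes t: "kbanach t"
  shows "closed (compact_ops s t)"
proof -
  have "T \<in> compact_ops s t" if T: "T \<in> closure (compact_ops s t)" for T
  proof -
    have "compact_ops s t \<subseteq> bounded_ops s t"
      by (auto simp: compact_ops_def)
    then have "T \<in> bounded_ops s t"
      using T closed_bounded_ops[OF t] closure_minimal by blast
    moreover have "totally_bounded (blinfun_apply T ` cball 0 1)"
    proof (rule totally_bounded_approx)
      fix e :: real assume "0 < e"
      then obtain K where K: "K \<in> compact_ops s t" "dist K T < e"
        using T by (auto simp: closure_approachable)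
      have "dist (blinfun_apply K x) (blinfun_apply T x) < e" if "norm x \<le> 1" for x
      proof -
        have "dist (blinfun_apply K x) (blinfun_apply T x) \<le> norm (K - T) * norm x"
          using norm_blinfun[of "K - T" x] by (simp add: dist_norm blinfun.diff_left)
        also have "\<dots> \<le> norm (K - T) * 1"
          using that by (intro mult_left_mono) auto
        finally show ?thesis
          using K(2) by (simp add: dist_norm)
      qed
      then have "\<forall>y\<in>blinfun_apply T ` cball 0 1. \<exists>a\<in>blinfun_apply K ` cball 0 1. dist a y < e"
        by (simp only: ball_simps bex_simps) (metis mem_cball_0)
      then show "\<exists>A. totally_bounded A \<and> (\<forall>y\<in>blinfun_apply T ` cball 0 1. \<exists>a\<in>A. dist a y < e)"
        using K(1) unfolding compact_ops_iff by blast
    qed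
    ultimately show ?thesis
      by (simp add: compact_ops_iff)
  qed
  then show ?thesis
    using closure_subset by (metis closure_closed closed_closure subsetI subset_antisym)
qed

lemma finite_rank_imp_compact:
  fixes t :: "'k::{real_normed_field,euclidean_space} \<Rightarrow> 'y::banach \<Rightarrow> 'y"
  assumes t: "kbanach t" and T: "T \<in> finite_rank_ops s t"
  shows "T \<in> compact_ops s t"
proof -
  interpret t: kbanach t by fact
  obtain B where B: "finite B" "range (blinfun_apply T) \<subseteq> t.span B"
    using T by (auto simp: finite_rank_ops_def)
  have "totally_bounded (blinfun_apply T ` cball 0 1)"
    by (rule t.totally_bounded_in_finite_span[OF B(1)])
      (use B(2) in \<open>auto intro!: bounded_linear_image blinfun.bounded_linear_right\<close>)
  then show ?thesis
    using T by (simp add: compact_ops_iff finite_rank_ops_def)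
qed

definition rank_one ::
  "('k::real_normed_field \<Rightarrow> 'y::real_normed_vector \<Rightarrow> 'y) \<Rightarrow> 'y \<Rightarrow> ('x::real_normed_vector \<Rightarrow>\<^sub>L 'k) \<Rightarrow> 'x \<Rightarrow>\<^sub>L 'y"
  where "rank_one t u f = Blinfun (\<lambda>c. t c u) o\<^sub>L f"

lemma rank_one_apply:
  "kbanach t \<Longrightarrow> blinfun_apply (rank_one t u f) x = t (blinfun_apply f x) u"
  by (simp add: rank_one_def bounded_linear_Blinfun_apply kbanach.bounded_linear_scale_left)

lemma rank_one_bounded_ops:
  assumes "kbanach t" "f \<in> bounded_ops s (*)"
  shows "rank_one t u f \<in> bounded_ops s t"
proof -
  interpret t: kbanach t by fact
  show ?thesis
    using assms(2) by (intro bounded_opsI) (simp add: rank_one_apply[OF assms(1)] bounded_opsD)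
qed

text \<open>Removes one spanning vector \<open>v\<close> at a time. The coefficient of
  \<open>v\<close> modulo the span of the others is unique and bounded because \<open>v\<close> has
  positive distance from that closed span, so it is a functional, and subtracting its rank-one
  operator leaves the range in the smaller span.\<close>

lemma finite_rank_induct [consumes 2, case_names zero add rank_one]:
  fixes t :: "'k::{real_normed_field,euclidean_space} \<Rightarrow> 'y::banach \<Rightarrow> 'y"
    and s :: "'k \<Rightarrow> 'x::real_normed_vector \<Rightarrow> 'x"
  assumes t: "kbanach t" and T: "T \<in> finite_rank_ops s t"
    and zero: "P 0"
    and add: "\<And>S T. P S \<Longrightarrow> P T \<Longrightarrow> P (S + T)"
    and rank_one: "\<And>u f. f \<in> bounded_ops s (*) \<Longrightarrow> P (rank_one t u f)"
  shows "P T"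
proof -
  interpret t: kbanach t by fact
  have "P T" if "finite B" "T \<in> bounded_ops s t" "range (blinfun_apply T) \<subseteq> t.span B" for B T
    using that
  proof (induction B arbitrary: T rule: finite_induct)
    case empty
    then have "blinfun_apply T x = 0" for x
      by auto
    then have "T = 0"
      by (intro blinfun_eqI) simp
    then show ?case
      using zero by simp
  next
    case (insert v B)
    show ?case
    proof (cases "v \<in> t.span B")
      case True
      then show ?thesis
        using insert by (simp add: t.span_redundant)
    next
      case False
      obtain d where d: "0 < d" "\<And>s c. s \<in> t.span B \<Longrightarrow> norm c * d \<le> norm (s + t c v)"
        using t.dist_subspace_bound[OF t.subspace_span t.closed_span_finite[OF insert(1)] False]
        by blast
      have "\<forall>x. \<exists>c. blinfun_apply T x - t c v \<in> t.span B"
        using insert.prems(2) unfolding t.span_breakdown_eq[symmetric] by blast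
      then obtain c where c: "\<And>x. blinfun_apply T x - t (c x) v \<in> t.span B"
        by metis
      have uniq: "c x = a" if "blinfun_apply T x - t a v \<in> t.span B" for x a
      proof -
        have "norm (c x - a) * d \<le> 0"
          using d(2)[OF t.span_diff[OF c[of x] that], of "c x - a"]
          by (simp add: t.scale_left_diff_distrib)
        then show ?thesis
          using d(1) by (simp add: mult_le_0_iff)
      qed
      have c_add: "c (x + y) = c x + c y" for x y
        using t.span_add[OF c[of x] c[of y]]
        by (intro uniq) (simp add: blinfun.add_right t.scale_left_distrib algebra_simps)
      have c_scale: "c (s a x) = a * c x" for a x
        using t.span_scale[OF c[of x], of a]
        by (intro uniq) (simp add: bounded_opsD[OF insert.prems(1)] t.scale_right_diff_distrib)
      have "bounded_linear c"
      proof (rule bounded_linear_intro[OF c_add])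
        show "c (r *\<^sub>R x) = r *\<^sub>R c x" for r x
          using t.span_scale[OF c[of x], of "of_real r"]
          by (intro uniq)
            (simp add: blinfun.scaleR_right t.scale_right_diff_distrib t.scale_of_real
              scaleR_conv_of_real flip: t.scale_scale)
        show "norm (c x) \<le> norm x * (norm T / d)" for x
        proof -
          have "norm (c x) * d \<le> norm T * norm x"
            using d(2)[OF c[of x], of "c x"] norm_blinfun[of T x] by simp
          then show ?thesis
            using d(1) by (simp add: field_simps)
        qed
      qed
      then have f: "blinfun_apply (Blinfun c) = c"
        by (rule bounded_linear_Blinfun_apply)
      have f_op: "Blinfun c \<in> bounded_ops s (*)"
        by (rule bounded_opsI) (simp add: f c_scale)
      have "P (T - rank_one t v (Blinfun c))"
      proof (rule insert.IH)
        show "T - rank_one t v (Blinfun c) \<in> bounded_ops s t"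
          by (intro bounded_ops_diff t insert.prems(1) rank_one_bounded_ops f_op)
        show "range (blinfun_apply (T - rank_one t v (Blinfun c))) \<subseteq> t.span B"
          using c by (auto simp: blinfun.diff_left rank_one_apply[OF t] f)
      qed
      from add[OF this rank_one[OF f_op, of v]] show ?thesis
        by simp
    qed
  qed
  then show ?thesis
    using T by (auto simp: finite_rank_ops_def)
qed

lemma norm_blinfun_le_if_unit_ball:
  assumes "\<And>x. norm x \<le> 1 \<Longrightarrow> norm (blinfun_apply T x) \<le> e" "0 \<le> e"
  shows "norm T \<le> e"
proof (rule norm_blinfun_bound[OF assms(2)])
  fix x
  show "norm (blinfun_apply T x) \<le> e * norm x"
  proof (cases "x = 0")
    case False
    then have "norm (blinfun_apply T ((1 / norm x) *\<^sub>R x)) \<le> e"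
      by (intro assms(1)) simp
    then show ?thesis
      using False by (simp add: blinfun.scaleR_right field_simps)
  qed simp
qed

section \<open>The bounded approximation property and its consequences\<close>

locale bounded_approximation = kbanach s
  for s :: "'k::{real_normed_field,euclidean_space} \<Rightarrow> 'x::banach \<Rightarrow> 'x" +
  fixes R :: "nat \<Rightarrow> 'x \<Rightarrow>\<^sub>L 'x" and C :: real
  assumes finite_rank: "\<And>n. R n \<in> finite_rank_ops s s"
    and norm_bound: "\<And>n. norm (R n) \<le> C"
    and pointwise: "\<And>x. (\<lambda>n. blinfun_apply (R n) x) \<longlonglongrightarrow> x"
begin

text \<open>Uniformly bounded operators that converge pointwise converge uniformly on totally
  bounded sets, here on the image of the unit ball under \<open>K\<close>.\<close>

lemma approximates_compact:
  assumes K: "K \<in> compact_ops r s"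
  shows "(\<lambda>n. R n o\<^sub>L K) \<longlonglongrightarrow> K"
proof (rule LIMSEQ_I)
  fix e :: real assume e: "0 < e"
  \<comment> \<open>The error is at most \<open>C * \<epsilon>\<close> from \<open>R n\<close> on
    \<open>y - f\<close> plus \<open>\<epsilon>\<close> twice; 3 instead of 2 makes the final
    inequality strict.\<close>
  define \<epsilon> where "\<epsilon> = e / (C + 3)"
  have C: "0 \<le> C"
    using norm_bound[of 0] norm_ge_zero order_trans by blast
  have \<epsilon>: "0 < \<epsilon>"
    using e C by (simp add: \<epsilon>_def)
  obtain F where F: "finite F" "\<And>y. y \<in> blinfun_apply K ` cball 0 1 \<Longrightarrow> \<exists>f\<in>F. dist f y < \<epsilon>"
    using K \<epsilon> unfolding compact_ops_iff totally_bounded_iff_dist by meson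
  have "\<forall>f\<in>F. \<forall>\<^sub>F n in sequentially. dist (blinfun_apply (R n) f) f < \<epsilon>"
    using pointwise \<epsilon> by (auto dest: tendstoD)
  then have "\<forall>\<^sub>F n in sequentially. \<forall>f\<in>F. dist (blinfun_apply (R n) f) f < \<epsilon>"
    by (simp add: eventually_ball_finite[OF F(1)])
  then obtain N where N: "\<And>n f. N \<le> n \<Longrightarrow> f \<in> F \<Longrightarrow> dist (blinfun_apply (R n) f) f < \<epsilon>"
    unfolding eventually_sequentially by blast
  have "norm ((R n o\<^sub>L K) - K) < e" if "N \<le> n" for n
  proof -
    have "norm (blinfun_apply ((R n o\<^sub>L K) - K) x) \<le> (C + 2) * \<epsilon>" if x: "norm x \<le> 1" for x
    proof -
      define y where "y = blinfun_apply K x"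
      obtain f where f: "f \<in> F" "dist f y < \<epsilon>"
        using F(2)[of y] x by (auto simp: y_def)
      have "norm (blinfun_apply (R n) (y - f)) \<le> C * \<epsilon>"
        using norm_blinfun[of "R n" "y - f"] norm_bound[of n] f(2) C \<epsilon>
          mult_mono[of "norm (R n)" C "norm (y - f)" \<epsilon>]
        by (simp add: dist_norm norm_minus_commute)
      moreover have "blinfun_apply (R n) y - y
          = blinfun_apply (R n) (y - f) + (blinfun_apply (R n) f - f) + (f - y)"
        by (simp add: blinfun.diff_right)
      ultimately have "norm (blinfun_apply (R n) y - y) \<le> C * \<epsilon> + \<epsilon> + \<epsilon>"
        using N[OF \<open>N \<le> n\<close> f(1)] f(2)
          norm_triangle_ineq[of "blinfun_apply (R n) (y - f) + (blinfun_apply (R n) f - f)" "f - y"]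
          norm_triangle_ineq[of "blinfun_apply (R n) (y - f)" "blinfun_apply (R n) f - f"]
        by (simp add: dist_norm)
      moreover have "blinfun_apply ((R n o\<^sub>L K) - K) x = blinfun_apply (R n) y - y"
        by (simp add: blinfun.diff_left y_def)
      ultimately show ?thesis
        by (simp add: distrib_right)
    qed
    then have "norm ((R n o\<^sub>L K) - K) \<le> (C + 2) * \<epsilon>"
      using C \<epsilon> by (intro norm_blinfun_le_if_unit_ball) auto
    also have "\<dots> < e"
      using C e by (simp add: \<epsilon>_def field_simps)
    finally show ?thesis .
  qed
  then show "\<exists>N. \<forall>n\<ge>N. norm ((R n o\<^sub>L K) - K) < e"
    by blast
qed

lemma finite_rank_compose:
  assumes "K \<in> bounded_ops s s"
  shows "R n o\<^sub>L K \<in> finite_rank_ops s s"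
  using finite_rank[of n] assms by (auto simp: finite_rank_ops_def bounded_ops_compose)

text \<open>Lets the quotient in \<open>inessential_ops\<close> be read as the Calkin
  algebra.\<close>

lemma closure_finite_rank_ops: "closure (finite_rank_ops s s) = compact_ops s s"
proof
  have "finite_rank_ops s s \<subseteq> compact_ops s s"
    using finite_rank_imp_compact[OF kbanach_axioms] by blast
  then show "closure (finite_rank_ops s s) \<subseteq> compact_ops s s"
    by (rule closure_minimal) (rule closed_compact_ops[OF kbanach_axioms])
  show "compact_ops s s \<subseteq> closure (finite_rank_ops s s)"
  proof
    fix K assume "K \<in> compact_ops s s"
    then show "K \<in> closure (finite_rank_ops s s)"
      unfolding closure_sequential
      by (intro exI[of _ "\<lambda>n. R n o\<^sub>L K"])
        (auto intro: approximates_compact finite_rank_compose compact_imp_bounded_op)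
  qed
qed

text \<open>If a functional \<open>f\<close> has the value \<open>c \<noteq> 0\<close> at
  \<open>T x\<close>, then composing \<open>T\<close> on the right with the operator sending
  \<open>y\<close> to \<open>g y\<close> times \<open>x\<close>, and on the left with the one
  sending \<open>z\<close> to \<open>f z / c\<close> times \<open>u\<close>, gives the rank-one
  operator of \<open>u\<close> and \<open>g\<close>.\<close>

lemma nonzero_ideal_contains_finite_rank:
  assumes I: "ideal I (op_ring s)" and T: "T \<in> I" "T \<noteq> 0"
  shows "finite_rank_ops s s \<subseteq> I"
proof
  interpret I: ideal I "op_ring s" by fact
  fix S assume S: "S \<in> finite_rank_ops s s"
  obtain x where x: "blinfun_apply T x \<noteq> 0"
    using T(2) by (metis blinfun_eqI blinfun.zero_left)
  \<comment> \<open>A vector killed by all functionals is killed by all rank-one operators, hence by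
    every \<open>R n\<close>, and so is 0. This takes the place of the Hahn-Banach theorem.\<close>
  have "\<exists>f\<in>bounded_ops s (*). blinfun_apply f (blinfun_apply T x) \<noteq> 0"
  proof (rule ccontr)
    assume *: "\<not> ?thesis"
    have "blinfun_apply (R n) (blinfun_apply T x) = 0" for n
      using kbanach_axioms finite_rank
      by (induction rule: finite_rank_induct)
        (use * in \<open>auto simp: blinfun.add_left rank_one_apply[OF kbanach_axioms]\<close>)
    then show False
      using pointwise[of "blinfun_apply T x"] x by (simp add: LIMSEQ_const_iff)
  qed
  then obtain f where f: "f \<in> bounded_ops s (*)" "blinfun_apply f (blinfun_apply T x) \<noteq> 0"
    by blast
  have T_op: "T \<in> bounded_ops s s"
    using I.Icarr[OF T(1)] by (simp add: op_ring_def)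
  from kbanach_axioms S show "S \<in> I"
  proof (induction rule: finite_rank_induct)
    case zero
    show ?case
      using additive_subgroup.zero_closed[OF I.additive_subgroup_axioms] by (simp add: op_ring_def)
  next
    case (add S T)
    then show ?case
      using additive_subgroup.a_closed[OF I.additive_subgroup_axioms] by (simp add: op_ring_def)
  next
    case (rank_one u g)
    define c where "c = blinfun_apply f (blinfun_apply T x)"
    have "rank_one s u g = rank_one s (s (inverse c) u) f o\<^sub>L (T o\<^sub>L rank_one s x g)"
      using f(2)
      by (intro blinfun_eqI)
        (simp add: rank_one_apply[OF kbanach_axioms] bounded_opsD[OF T_op] bounded_opsD[OF f(1)]
          c_def)
    also have "\<dots> \<in> I"
      using I.I_l_closed[OF I.I_r_closed[OF T(1)]]
        rank_one_bounded_ops[OF kbanach_axioms f(1)] rank_one_bounded_ops[OF kbanach_axioms rank_one]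
      by (simp add: op_ring_def)
    finally show ?case .
  qed
qed

lemma nonzero_closed_ideal_contains_compact:
  assumes "ideal I (op_ring s)" "closed I" "I \<noteq> {0}"
  shows "compact_ops s s \<subseteq> I"
proof -
  have "0 \<in> I"
    using additive_subgroup.zero_closed[OF ideal.axioms(1)[OF assms(1)]] by (simp add: op_ring_def)
  then obtain T where "T \<in> I" "T \<noteq> 0"
    using assms(3) by blast
  then show ?thesis
    using nonzero_ideal_contains_finite_rank[OF assms(1)] assms(2) closure_minimal
    by (metis closure_finite_rank_ops)
qed

end

section \<open>The Jacobson radical of a quotient ring\<close>

lemma (in ring) left_idealI:
  assumes "N \<subseteq> carrier R" "\<zero> \<in> N" "\<And>x y. x \<in> N \<Longrightarrow> y \<in> N \<Longrightarrow> x \<oplus> y \<in> N"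
    and mult: "\<And>a x. a \<in> carrier R \<Longrightarrow> x \<in> N \<Longrightarrow> a \<otimes> x \<in> N"
  shows "left_ideal N R"
proof -
  have "\<ominus> x \<in> N" if "x \<in> N" for x
  proof -
    have "\<ominus> x = (\<ominus> \<one>) \<otimes> x"
      using that assms(1) by (simp add: l_minus subset_iff)
    then show ?thesis
      using mult[of "\<ominus> \<one>" x] that by simp
  qed
  then have "subgroup N (add_monoid R)"
    using assms by (intro add.subgroupI) (auto simp: a_inv_def)
  then show ?thesis
    using mult by (auto simp: left_ideal_def additive_subgroup_def)
qed

text \<open>If a maximal left ideal \<open>M\<close> missed \<open>t\<close>, then \<open>M\<close>
  and the multiples of \<open>t\<close> would generate the ring, so 1 is \<open>m\<close> plus a
  multiple \<open>q\<close> of \<open>t\<close> with square zero. But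
  \<open>\<one> \<oplus> q\<close> is a left inverse of \<open>m\<close>, which forces 1 into
  \<open>M\<close>.\<close>

lemma (in ring) nil_square_in_jacobson_radical:
  assumes t: "t \<in> carrier R"
    and nil: "\<And>r. r \<in> carrier R \<Longrightarrow> (r \<otimes> t) \<otimes> (r \<otimes> t) = \<zero>"
  shows "t \<in> jacobson_radical R"
proof -
  have "t \<in> M" if "maximal_left_ideal M R" for M
  proof (rule ccontr)
    assume tM: "t \<notin> M"
    have M: "left_ideal M R" "M \<noteq> carrier R"
      and max: "\<And>N. left_ideal N R \<Longrightarrow> M \<subseteq> N \<Longrightarrow> N = M \<or> N = carrier R"
      using that by (auto simp: maximal_left_ideal_def)
    interpret M: additive_subgroup M R
      using M(1) by (simp add: left_ideal_def)
    have mult: "a \<otimes> m \<in> M" if "a \<in> carrier R" "m \<in> M" for a m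
      using M(1) that by (simp add: left_ideal_def)
    define N where "N = {m \<oplus> r \<otimes> t |m r. m \<in> M \<and> r \<in> carrier R}"
    have mem: "m \<oplus> r \<otimes> t \<in> N" if "m \<in> M" "r \<in> carrier R" for m r
      using that by (auto simp: N_def)
    have "left_ideal N R"
    proof (rule left_idealI)
      show "N \<subseteq> carrier R"
        using t by (auto simp: N_def)
      show "\<zero> \<in> N"
        using mem[OF M.zero_closed zero_closed] t by simp
      show "x \<oplus> y \<in> N" if xy: "x \<in> N" "y \<in> N" for x y
      proof -
        obtain m r m' r' where "x = m \<oplus> r \<otimes> t" "y = m' \<oplus> r' \<otimes> t"
          and mr: "m \<in> M" "m' \<in> M" "r \<in> carrier R" "r' \<in> carrier R"
          using xy by (auto simp: N_def)
        then have "x \<oplus> y = (m \<oplus> m') \<oplus> (r \<oplus> r') \<otimes> t"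
          using t by (simp add: l_distr a_ac)
        then show ?thesis
          using mem[of "m \<oplus> m'" "r \<oplus> r'"] mr by simp
      qed
      show "a \<otimes> x \<in> N" if a: "a \<in> carrier R" and x: "x \<in> N" for a x
      proof -
        obtain m r where "x = m \<oplus> r \<otimes> t" and mr: "m \<in> M" "r \<in> carrier R"
          using x by (auto simp: N_def)
        then have "a \<otimes> x = a \<otimes> m \<oplus> (a \<otimes> r) \<otimes> t"
          using t a by (simp add: r_distr m_assoc)
        then show ?thesis
          using mem[of "a \<otimes> m" "a \<otimes> r"] mr a mult by simp
      qed
    qed
    moreover have "M \<subseteq> N"
      using mem[OF _ zero_closed] t by fastforce
    moreover have "t \<in> N"
      using mem[OF M.zero_closed one_closed] t by simp
    ultimately have "\<one> \<in> N"
      using max[of N] tM by auto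
    then obtain m r where one: "\<one> = m \<oplus> r \<otimes> t" and mr: "m \<in> M" "r \<in> carrier R"
      by (auto simp: N_def)
    have mc: "m \<in> carrier R"
      using mr by simp
    define q where "q = r \<otimes> t"
    have q: "q \<in> carrier R" "q \<otimes> q = \<zero>"
      using nil mr t by (simp_all add: q_def)
    have "m \<oplus> q = \<one>"
      by (simp add: one q_def)
    then have "q \<otimes> (m \<oplus> q) = q"
      using q by simp
    then have "q \<otimes> m = q"
      using q mc by (simp add: r_distr)
    then have "(\<one> \<oplus> q) \<otimes> m = \<one>"
      using q mc \<open>m \<oplus> q = \<one>\<close> by (simp add: l_distr)
    then have "\<one> \<in> M"
      using mult[of "\<one> \<oplus> q" m] q mr by simp
    then have "carrier R \<subseteq> M"
      using mult[of _ \<one>] by force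
    then show False
      using M(2) by auto
  qed
  then show ?thesis
    using t by (auto simp: jacobson_radical_def)
qed

lemma (in ideal) rcos_in_jacobson_radicalI:
  assumes t: "t \<in> carrier R"
    and nil: "\<And>r. r \<in> carrier R \<Longrightarrow> (r \<otimes> t) \<otimes> (r \<otimes> t) \<in> I"
  shows "I +> t \<in> jacobson_radical (R Quot I)"
proof -
  interpret Q: ring "R Quot I"
    by (rule quotient_is_ring)
  show ?thesis
  proof (rule Q.nil_square_in_jacobson_radical)
    show "I +> t \<in> carrier (R Quot I)"
      using t by (auto simp: FactRing_simps)
    fix q assume "q \<in> carrier (R Quot I)"
    then obtain r where r: "r \<in> carrier R" "q = I +> r"
      by (auto simp: FactRing_simps)
    then show "(q \<otimes>\<^bsub>R Quot I\<^esub> (I +> t)) \<otimes>\<^bsub>R Quot I\<^esub> (q \<otimes>\<^bsub>R Quot I\<^esub> (I +> t)) = \<zero>\<^bsub>R Quot I\<^esub>"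
      using nil[OF r(1)] t by (simp add: FactRing_def rcoset_mult_add a_coset_join2 a_rcos_const)
  qed
qed

text \<open>The assumption \<open>inv\<close> says that every element outside \<open>M\<close> is
  left invertible modulo \<open>M\<close>. Hence the image of \<open>M\<close> in the quotient is a
  maximal left ideal, and the radical lies inside it.\<close>

lemma (in ideal) jacobson_radical_quot_le:
  assumes M: "ideal M R" "I \<subseteq> M" "M \<noteq> carrier R"
    and inv: "\<And>x. x \<in> carrier R \<Longrightarrow> x \<notin> M \<Longrightarrow> \<exists>r\<in>carrier R. \<one> \<ominus> r \<otimes> x \<in> M"
    and t: "t \<in> carrier R" "I +> t \<in> jacobson_radical (R Quot I)"
  shows "t \<in> M"
proof -
  interpret M: ideal M R by fact
  interpret Q: ring "R Quot I"
    by (rule quotient_is_ring)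
  define N where "N = (+>) I ` M"
  \<comment> \<open>As \<open>I \<subseteq> M\<close>, membership in \<open>M\<close> does not
    depend on the representative of a coset.\<close>
  have in_N: "x \<in> M" if x: "x \<in> carrier R" "I +> x \<in> N" for x
  proof -
    obtain m where m: "m \<in> M" "I +> x = I +> m"
      using x(2) by (auto simp: N_def)
    then have "x \<in> I +> m"
      using a_rcos_self[OF x(1)] by simp
    then obtain i where "i \<in> I" "x = i \<oplus> m"
      by (auto simp: a_r_coset_def r_coset_def)
    then show ?thesis
      using m(1) M(2) by auto
  qed
  have "left_ideal N (R Quot I)"
  proof (rule Q.left_idealI)
    show "N \<subseteq> carrier (R Quot I)"
      unfolding N_def FactRing_simps using M.Icarr by fastforce
    show "\<zero>\<^bsub>R Quot I\<^esub> \<in> N"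
      using additive_subgroup.zero_closed[OF M.additive_subgroup_axioms]
        a_rcos_const[OF additive_subgroup.zero_closed[OF additive_subgroup_axioms]]
      by (force simp: N_def FactRing_def)
    show "x \<oplus>\<^bsub>R Quot I\<^esub> y \<in> N" if "x \<in> N" "y \<in> N" for x y
      using that M.Icarr by (auto simp: N_def FactRing_def a_rcos_sum)
    show "a \<otimes>\<^bsub>R Quot I\<^esub> x \<in> N" if "a \<in> carrier (R Quot I)" "x \<in> N" for a x
      using that M.Icarr M.I_l_closed by (auto simp: N_def FactRing_simps rcoset_mult_add)
  qed
  moreover have "N \<noteq> carrier (R Quot I)"
  proof
    assume "N = carrier (R Quot I)"
    then have "carrier R \<subseteq> M"
      using in_N by (auto simp: FactRing_simps)
    then show False
      using M(3) M.a_subset by auto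
  qed
  moreover have "N' = carrier (R Quot I)"
    if N': "left_ideal N' (R Quot I)" "N \<subseteq> N'" "N' \<noteq> N" for N'
  proof -
    interpret N': additive_subgroup N' "R Quot I"
      using N'(1) by (simp add: left_ideal_def)
    have mult: "a \<otimes>\<^bsub>R Quot I\<^esub> x \<in> N'" if "a \<in> carrier (R Quot I)" "x \<in> N'" for a x
      using N'(1) that by (simp add: left_ideal_def)
    obtain q where q: "q \<in> N'" "q \<notin> N"
      using N' by blast
    then obtain x where x: "x \<in> carrier R" "q = I +> x"
      using N'.a_subset by (auto simp: FactRing_simps)
    then have "x \<notin> M"
      using q(2) by (auto simp: N_def)
    then obtain r where r: "r \<in> carrier R" "\<one> \<ominus> r \<otimes> x \<in> M"
      using inv x(1) by blast
    have "I +> (r \<otimes> x) \<in> N'"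
      using mult[of "I +> r" q] r(1) x q(1) by (auto simp: FactRing_simps rcoset_mult_add)
    moreover have "I +> (\<one> \<ominus> r \<otimes> x) \<in> N'"
      using r(2) N'(2) by (auto simp: N_def)
    ultimately have "I +> (\<one> \<ominus> r \<otimes> x \<oplus> r \<otimes> x) \<in> N'"
      using N'.a_closed[of "I +> (\<one> \<ominus> r \<otimes> x)" "I +> (r \<otimes> x)"] r(1) x(1)
      by (simp add: FactRing_def a_rcos_sum)
    moreover have "\<one> \<ominus> r \<otimes> x \<oplus> r \<otimes> x = \<one>"
      using r(1) x(1) by algebra
    ultimately have "\<one>\<^bsub>R Quot I\<^esub> \<in> N'"
      by (simp add: FactRing_def)
    then have "carrier (R Quot I) \<subseteq> N'"
      using mult[of _ "\<one>\<^bsub>R Quot I\<^esub>"] by force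
    then show ?thesis
      using N'.a_subset by auto
  qed
  ultimately have "maximal_left_ideal N (R Quot I)"
    by (auto simp: maximal_left_ideal_def)
  then have "I +> t \<in> N"
    using t(2) by (auto simp: jacobson_radical_def)
  then show ?thesis
    using in_N t(1) by blast
qed

section \<open>Operators on the direct sum\<close>

lemma ideal_op_ringI:
  assumes "kbanach s" "I \<subseteq> bounded_ops s s" "0 \<in> I"
    and add: "\<And>S T. S \<in> I \<Longrightarrow> T \<in> I \<Longrightarrow> S + T \<in> I"
    and left: "\<And>A T. A \<in> bounded_ops s s \<Longrightarrow> T \<in> I \<Longrightarrow> A o\<^sub>L T \<in> I"
    and right: "\<And>A T. A \<in> bounded_ops s s \<Longrightarrow> T \<in> I \<Longrightarrow> T o\<^sub>L A \<in> I"
  shows "ideal I (op_ring s)"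
proof -
  interpret ring "op_ring s"
    by (rule ring_op_ring) fact
  have "left_ideal I (op_ring s)"
    by (rule left_idealI) (use assms in \<open>auto simp: op_ring_def\<close>)
  then show ?thesis
    using left right
    by (intro idealI ring_axioms) (auto simp: left_ideal_def additive_subgroup_def op_ring_def)
qed

definition scalar_op :: "('k \<Rightarrow> 'x::real_normed_vector \<Rightarrow> 'x) \<Rightarrow> 'k \<Rightarrow> 'x \<Rightarrow>\<^sub>L 'x" where
  "scalar_op s c = Blinfun (s c)"

lemma scalar_op_apply [simp]: "kbanach s \<Longrightarrow> blinfun_apply (scalar_op s c) x = s c x"
  by (simp add: scalar_op_def bounded_linear_Blinfun_apply kbanach.bounded_linear_scale)

lemma scalar_op_bounded_ops:
  assumes "kbanach s"
  shows "scalar_op s c \<in> bounded_ops s s"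
proof -
  interpret kbanach s by fact
  show ?thesis
    by (rule bounded_opsI) (simp add: assms mult.commute)
qed

lemma scalar_op_not_compact:
  assumes s: "kbanach s" "infinite_dim s" and c: "c \<noteq> 0"
  shows "scalar_op s c \<notin> compact_ops s s"
proof
  interpret kbanach s by fact
  assume "scalar_op s c \<in> compact_ops s s"
  then have "scalar_op s (inverse c) o\<^sub>L scalar_op s c \<in> compact_ops s s"
    by (rule compact_ops_compose_left[OF scalar_op_bounded_ops[OF s(1)]])
  moreover have "blinfun_apply (scalar_op s (inverse c) o\<^sub>L scalar_op s c) = id"
    using c by (auto simp: s(1))
  ultimately show False
    using ball_not_totally_bounded[OF s(2)] by (simp add: compact_ops_iff)
qed

lemma compact_ops_uminus:
  assumes t: "kbanach t" and K: "K \<in> compact_ops s t"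
  shows "- K \<in> compact_ops s t"
proof -
  interpret kbanach t by fact
  have "scalar_op t (- 1) o\<^sub>L K = - K"
    by (rule blinfun_eqI) (simp add: t blinfun.minus_left)
  then show ?thesis
    using compact_ops_compose_left[OF scalar_op_bounded_ops[OF t] K] by metis
qed

lemma compact_ops_diff:
  assumes t: "kbanach t" and "S \<in> compact_ops s t" "T \<in> compact_ops s t"
  shows "S - T \<in> compact_ops s t"
  using compact_ops_add[OF t assms(2) compact_ops_uminus[OF t assms(3)]] by simp

lemma compact_ops_zero: "kbanach t \<Longrightarrow> 0 \<in> compact_ops s t"
  using bounded_ops_zero by (auto simp: compact_ops_iff totally_bounded_iff_dist exI[of _ "{0}"])

lemma ideal_compact_ops: "kbanach s \<Longrightarrow> ideal (compact_ops s s) (op_ring s)"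
  by (rule ideal_op_ringI)
    (auto intro: compact_imp_bounded_op compact_ops_zero compact_ops_add compact_ops_compose_left
      compact_ops_compose_right)

section \<open>Coordinate maps of the direct sum and isometric embeddings\<close>

definition ms_inl :: "'x::real_normed_vector \<Rightarrow>\<^sub>L ('x, 'y::real_normed_vector) maxsum" where
  "ms_inl = Blinfun (\<lambda>x. MS x 0)"
definition ms_inr :: "'y::real_normed_vector \<Rightarrow>\<^sub>L ('x::real_normed_vector, 'y) maxsum" where
  "ms_inr = Blinfun (\<lambda>y. MS 0 y)"
definition ms_fst :: "('x::real_normed_vector, 'y::real_normed_vector) maxsum \<Rightarrow>\<^sub>L 'x" where
  "ms_fst = Blinfun ms1"
definition ms_snd :: "('x::real_normed_vector, 'y::real_normed_vector) maxsum \<Rightarrow>\<^sub>L 'y" where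
  "ms_snd = Blinfun ms2"

lemma ms_inl_apply [simp]: "blinfun_apply ms_inl x = MS x 0"
  unfolding ms_inl_def
  by (subst bounded_linear_Blinfun_apply)
    (auto intro!: bounded_linear_intro[of _ 1] simp: maxsum_defs norm_maxsum_def)

lemma ms_inr_apply [simp]: "blinfun_apply ms_inr y = MS 0 y"
  unfolding ms_inr_def
  by (subst bounded_linear_Blinfun_apply)
    (auto intro!: bounded_linear_intro[of _ 1] simp: maxsum_defs norm_maxsum_def)

lemma ms_fst_apply [simp]: "blinfun_apply ms_fst z = ms1 z"
  unfolding ms_fst_def
  by (subst bounded_linear_Blinfun_apply)
    (auto intro!: bounded_linear_intro[of _ 1] simp: norm_maxsum_def)

lemma ms_snd_apply [simp]: "blinfun_apply ms_snd z = ms2 z"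
  unfolding ms_snd_def
  by (subst bounded_linear_Blinfun_apply)
    (auto intro!: bounded_linear_intro[of _ 1] simp: norm_maxsum_def)

lemma totally_bounded_isometric_preimage:
  assumes iso: "\<And>x y. dist (f x) (f y) = dist x y" and A: "totally_bounded (f ` A)"
  shows "totally_bounded A"
  unfolding totally_bounded_iff_dist
proof (intro allI impI)
  fix e :: real assume "0 < e"
  then obtain F where F: "finite F" "\<And>x. x \<in> f ` A \<Longrightarrow> \<exists>y\<in>F. dist y x < e / 2"
    using A unfolding totally_bounded_iff_dist by (meson half_gt_zero)
  \<comment> \<open>A net of the image may contain points outside the range of \<open>f\<close>.
    Each is replaced by a nearby point of that range, which is why the net is taken for
    \<open>e / 2\<close>.\<close>
  define g where "g y = (SOME a. dist y (f a) < e / 2)" for y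
  have "\<exists>a\<in>g ` F. dist a x < e" if x: "x \<in> A" for x
  proof -
    obtain y where y: "y \<in> F" "dist y (f x) < e / 2"
      using F(2) x by blast
    then have "dist y (f (g y)) < e / 2"
      unfolding g_def by (metis someI_ex)
    then have "dist (f (g y)) (f x) < e"
      using y(2) dist_triangle_half_r by blast
    then show ?thesis
      using y(1) iso by auto
  qed
  then show "\<exists>F. finite F \<and> (\<forall>x\<in>A. \<exists>y\<in>F. dist y x < e)"
    using F(1) by blast
qed

text \<open>The subspace is modelled by a Banach space type with an isometric inclusion, so that
  operators to and from it are ordinary bounded operators between types.\<close>

locale isometric_embedding = X: kbanach sX + Y: kbanach sY
  for sX :: "'k::{real_normed_field,euclidean_space} \<Rightarrow> 'x::banach \<Rightarrow> 'x"
    and sY :: "'k \<Rightarrow> 'y::banach \<Rightarrow> 'y" +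
  fixes J :: "'y \<Rightarrow>\<^sub>L 'x"
  assumes J_op: "J \<in> bounded_ops sY sX"
    and norm_J: "\<And>y. norm (blinfun_apply J y) = norm y"
begin

lemma dist_J: "dist (blinfun_apply J x) (blinfun_apply J y) = dist x y"
  by (simp add: dist_norm norm_J flip: blinfun.diff_right)

lemma J_inject: "blinfun_apply J x = blinfun_apply J y \<longleftrightarrow> x = y"
  using dist_J by (metis dist_eq_0_iff)

lemma J_hom: "module_hom sY sX (blinfun_apply J)"
  by unfold_locales (simp_all add: blinfun.add_right bounded_opsD[OF J_op])

lemma closed_range_J: "closed (range (blinfun_apply J))"
  by (rule complete_imp_closed)
    (rule complete_isometric_image[OF zero_less_one _ blinfun.bounded_linear_right],
      auto simp: norm_J complete_UNIV)

lemma compact_if_J_compact: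
  assumes "T \<in> bounded_ops s sY" "J o\<^sub>L T \<in> compact_ops s sX"
  shows "T \<in> compact_ops s sY"
proof -
  have "totally_bounded (blinfun_apply J ` blinfun_apply T ` cball 0 1)"
    using assms(2) by (simp add: compact_ops_iff image_image)
  then show ?thesis
    using assms(1) totally_bounded_isometric_preimage[OF dist_J] by (auto simp: compact_ops_iff)
qed

text \<open>\<open>J\<close> is injective and preserves norms, so linearity and the norm bound of
  the lift can both be checked after applying \<open>J\<close>. Used to restrict the basis
  projections to the subspace.\<close>

lemma factor_through_J:
  assumes T: "T \<in> bounded_ops s sX" "range (blinfun_apply T) \<subseteq> range (blinfun_apply J)"
  obtains S where "S \<in> bounded_ops s sY" "J o\<^sub>L S = T" "norm S \<le> norm T"
proof -
  define S where "S x = inv_into UNIV (blinfun_apply J) (blinfun_apply T x)" for x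
  have S: "blinfun_apply J (S x) = blinfun_apply T x" for x
    unfolding S_def using T(2) by (intro f_inv_into_f) auto
  have norm_T: "norm (blinfun_apply T x) \<le> norm x * norm T" for x
    using norm_blinfun[of T x] by (simp only: mult.commute)
  have bl: "bounded_linear S"
    by (rule bounded_linear_intro[of _ "norm T"])
      (simp_all add: S blinfun.add_right blinfun.scaleR_right norm_T flip: J_inject norm_J)
  note [simp] = bounded_linear_Blinfun_apply[OF bl]
  show thesis
  proof
    show "Blinfun S \<in> bounded_ops s sY"
      by (rule bounded_opsI)
        (simp add: S bounded_opsD[OF J_op] bounded_opsD[OF T(1)] flip: J_inject)
    show "J o\<^sub>L Blinfun S = T"
      by (rule blinfun_eqI) (simp add: S)
    show "norm (Blinfun S) \<le> norm T"
      by (rule norm_blinfun_bound) (simp_all add: S norm_blinfun flip: norm_J)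
  qed
qed

text \<open>A basis projection sends each basis vector to itself or to 0, so it respects the closed
  span of any set of basis vectors. \<open>Q n\<close> is the restriction of \<open>P n\<close> to
  that span, and \<open>R n\<close> is their diagonal sum; with the maximum norm the constant
  \<open>C\<close> is kept.\<close>

lemma bounded_approximation_maxsum:
  assumes basis: "schauder_basis sX b"
    and Y: "range (blinfun_apply J) = closure (X.span (b ` N))"
  obtains R C where "bounded_approximation (ms_scale sX sY) R C"
proof -
  obtain P C where P: "\<And>n. P n \<in> bounded_ops sX sX"
    and norm_P: "\<And>n. norm (P n) \<le> C"
    and P_lim: "\<And>x. (\<lambda>n. blinfun_apply (P n) x) \<longlonglongrightarrow> x"
    and P_range: "\<And>n. range (blinfun_apply (P n)) \<subseteq> X.span (b ` {..<n})"
    and P_basis: "\<And>n k. blinfun_apply (P n) (b k) = (if k < n then b k else 0)"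
    using X.schauder_basis_projections[OF basis] by blast
  define W where "W n = X.span (b ` ({..<n} \<inter> N))" for n
  have PJ: "blinfun_apply (P n) (blinfun_apply J y) \<in> W n" for n y
  proof -
    interpret P: module_hom sX sX "blinfun_apply (P n)"
      by unfold_locales (simp_all add: blinfun.add_right bounded_opsD[OF P])
    have "b ` N \<subseteq> blinfun_apply (P n) -` W n"
      by (auto simp: P_basis W_def X.span_zero intro!: X.span_base imageI)
    then have "X.span (b ` N) \<subseteq> blinfun_apply (P n) -` W n"
      by (rule X.span_minimal) (simp add: P.subspace_vimage W_def)
    moreover have "closed (blinfun_apply (P n) -` W n)"
      by (intro closed_vimage)
        (auto simp: W_def intro!: X.closed_span_finite linear_continuous_on
          blinfun.bounded_linear_right)
    ultimately have "range (blinfun_apply J) \<subseteq> blinfun_apply (P n) -` W n"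
      unfolding Y by (rule closure_minimal)
    then show ?thesis
      by auto
  qed
  \<comment> \<open>The finite rank of \<open>Q n\<close> has to be witnessed inside
    \<open>'y\<close>, so the spanning vectors are pulled back along \<open>J\<close>.\<close>
  have W_eq: "\<exists>B. finite B \<and> W n = blinfun_apply J ` Y.span B" for n
  proof -
    have "b ` ({..<n} \<inter> N) \<subseteq> range (blinfun_apply J)"
      unfolding Y using closure_subset X.span_superset by fast
    then obtain B where B: "finite B" "b ` ({..<n} \<inter> N) = blinfun_apply J ` B"
      by (metis finite_Int finite_imageI finite_lessThan finite_subset_image)
    then show ?thesis
      by (auto simp: W_def module_hom.span_image[OF J_hom])
  qed
  have "\<exists>Q. Q \<in> bounded_ops sY sY \<and> J o\<^sub>L Q = P n o\<^sub>L J \<and> norm Q \<le> C" for n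
  proof -
    have "range (blinfun_apply (P n o\<^sub>L J)) \<subseteq> range (blinfun_apply J)"
      using PJ[of n] W_eq[of n] by fastforce
    then obtain Q where "Q \<in> bounded_ops sY sY" "J o\<^sub>L Q = P n o\<^sub>L J" "norm Q \<le> norm (P n o\<^sub>L J)"
      using factor_through_J[OF bounded_ops_compose[OF P J_op]] by metis
    moreover have "norm (P n o\<^sub>L J) \<le> norm (P n)"
    proof (rule norm_blinfun_bound)
      show "norm (blinfun_apply (P n o\<^sub>L J) y) \<le> norm (P n) * norm y" for y
        using norm_blinfun[of "P n" "blinfun_apply J y"] by (simp add: norm_J)
    qed simp
    ultimately show ?thesis
      using norm_P[of n] by force
  qed
  then obtain Q where Q: "\<And>n. Q n \<in> bounded_ops sY sY" "\<And>n. J o\<^sub>L Q n = P n o\<^sub>L J"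
    and norm_Q: "\<And>n. norm (Q n) \<le> C"
    by metis
  have JQ: "blinfun_apply J (blinfun_apply (Q n) y) = blinfun_apply (P n) (blinfun_apply J y)" for n y
    using arg_cong[OF Q(2)[of n], of "\<lambda>T. blinfun_apply T y"] by simp
  have Q_lim: "(\<lambda>n. blinfun_apply (Q n) y) \<longlonglongrightarrow> y" for y
    using P_lim[of "blinfun_apply J y"] unfolding tendsto_iff JQ[symmetric] dist_J .
  interpret Z: kbanach "ms_scale sX sY"
    by (intro kbanach_ms_scale X.kbanach_axioms Y.kbanach_axioms)
  define R where "R n = (ms_inl o\<^sub>L P n o\<^sub>L ms_fst) + (ms_inr o\<^sub>L Q n o\<^sub>L ms_snd)" for n
  have R: "blinfun_apply (R n) z = MS (blinfun_apply (P n) (ms1 z)) (blinfun_apply (Q n) (ms2 z))"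
    for n z
    by (simp add: R_def blinfun.add_left plus_maxsum_def)
  have "bounded_approximation (ms_scale sX sY) R C"
  proof
    fix n
    obtain B where B: "finite B" "W n = blinfun_apply J ` Y.span B"
      using W_eq by blast
    have Q_range: "blinfun_apply (Q n) y \<in> Y.span B" for y
      using PJ[of n y] unfolding JQ[symmetric] B(2) by (auto simp: J_inject)
    have inl: "module_hom sX (ms_scale sX sY) (\<lambda>x. MS x 0)"
      by unfold_locales (simp_all add: ms_scale_def plus_maxsum_def)
    have inr: "module_hom sY (ms_scale sX sY) (\<lambda>x. MS 0 x)"
      by unfold_locales (simp_all add: ms_scale_def plus_maxsum_def)
    define D where "D = (\<lambda>x. MS x 0) ` b ` {..<n} \<union> (\<lambda>y. MS 0 y) ` B"
    have "blinfun_apply (R n) z \<in> Z.span D" for z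
    proof -
      have "MS (blinfun_apply (P n) (ms1 z)) 0 \<in> Z.span ((\<lambda>x. MS x 0) ` b ` {..<n})"
        using P_range[of n] by (auto simp: module_hom.span_image[OF inl])
      moreover have "MS 0 (blinfun_apply (Q n) (ms2 z)) \<in> Z.span ((\<lambda>y. MS 0 y) ` B)"
        using Q_range by (auto simp: module_hom.span_image[OF inr])
      moreover have "blinfun_apply (R n) z =
          MS (blinfun_apply (P n) (ms1 z)) 0 + MS 0 (blinfun_apply (Q n) (ms2 z))"
        by (simp add: R plus_maxsum_def)
      ultimately show ?thesis
        unfolding D_def Z.span_Un by blast
    qed
    moreover have "R n \<in> bounded_ops (ms_scale sX sY) (ms_scale sX sY)"
      by (rule bounded_opsI) (simp add: R ms_scale_def bounded_opsD[OF P] bounded_opsD[OF Q(1)])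
    moreover have "finite D"
      using B(1) by (simp add: D_def)
    ultimately show "R n \<in> finite_rank_ops (ms_scale sX sY) (ms_scale sX sY)"
      unfolding finite_rank_ops_def by blast
    show "norm (R n) \<le> C"
    proof (rule norm_blinfun_bound)
      show "0 \<le> C"
        using norm_P[of 0] norm_ge_zero order_trans by blast
      fix z :: "('x, 'y) maxsum"
      have "norm (blinfun_apply (P n) (ms1 z)) \<le> C * norm z"
        using norm_blinfun[of "P n" "ms1 z"] norm_P[of n] \<open>0 \<le> C\<close>
          mult_mono[of "norm (P n)" C "norm (ms1 z)" "norm z"]
        by (simp add: norm_maxsum_def)
      moreover have "norm (blinfun_apply (Q n) (ms2 z)) \<le> C * norm z"
        using norm_blinfun[of "Q n" "ms2 z"] norm_Q[of n] \<open>0 \<le> C\<close>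
          mult_mono[of "norm (Q n)" C "norm (ms2 z)" "norm z"]
        by (simp add: norm_maxsum_def)
      ultimately show "norm (blinfun_apply (R n) z) \<le> C * norm z"
        by (simp add: R norm_maxsum_def[of "MS _ _"])
    qed
  next
    fix z :: "('x, 'y) maxsum"
    have "(\<lambda>n. blinfun_apply ms_inl (blinfun_apply (P n) (ms1 z)) +
        blinfun_apply ms_inr (blinfun_apply (Q n) (ms2 z))) \<longlonglongrightarrow>
        blinfun_apply ms_inl (ms1 z) + blinfun_apply ms_inr (ms2 z)"
      by (intro tendsto_add blinfun.tendsto tendsto_const P_lim Q_lim)
    then show "(\<lambda>n. blinfun_apply (R n) z) \<longlonglongrightarrow> z"
      by (simp add: R plus_maxsum_def)
  qed
  then show thesis
    by (rule that)
qed

end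

section \<open>The Calkin algebra of the direct sum\<close>

locale few_operator_pair = isometric_embedding sX sY J
  for sX :: "'k::{real_normed_field,euclidean_space} \<Rightarrow> 'x::banach \<Rightarrow> 'x"
    and sY :: "'k \<Rightarrow> 'y::banach \<Rightarrow> 'y"
    and J :: "'y \<Rightarrow>\<^sub>L 'x" +
  assumes few: "very_few_operators sX"
    and Y_infinite_dim: "infinite_dim sY"
    and codim: "infinite_codim sX (range (blinfun_apply J))"
    and few_J: "\<And>T. T \<in> bounded_ops sY sX \<Longrightarrow> \<exists>c. \<exists>K \<in> compact_ops sY sX.
      \<forall>y. blinfun_apply T y = sX c (blinfun_apply J y) + blinfun_apply K y"
begin

abbreviation sZ where "sZ \<equiv> ms_scale sX sY"
abbreviation B where "B \<equiv> bounded_ops sZ sZ"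
abbreviation K where "K \<equiv> compact_ops sZ sZ"

lemma kX: "kbanach sX" and kY: "kbanach sY" and kZ: "kbanach sZ"
  by (simp_all add: X.kbanach_axioms Y.kbanach_axioms kbanach_ms_scale)

lemma X_infinite_dim: "infinite_dim sX"
  using few by (simp add: very_few_operators_def)

lemma structure_maps [simp, intro]:
  "ms_inl \<in> bounded_ops sX sZ" "ms_inr \<in> bounded_ops sY sZ"
  "ms_fst \<in> bounded_ops sZ sX" "ms_snd \<in> bounded_ops sZ sY"
  by (simp_all add: bounded_ops_def ms_scale_def)

section \<open>Matrix entries, their scalars and the matrix units\<close>

definition comp11 :: "_ \<Rightarrow> 'x \<Rightarrow>\<^sub>L 'x" where "comp11 T = ms_fst o\<^sub>L T o\<^sub>L ms_inl"
definition comp12 :: "_ \<Rightarrow> 'y \<Rightarrow>\<^sub>L 'x" where "comp12 T = ms_fst o\<^sub>L T o\<^sub>L ms_inr"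
definition comp21 :: "_ \<Rightarrow> 'x \<Rightarrow>\<^sub>L 'y" where "comp21 T = ms_snd o\<^sub>L T o\<^sub>L ms_inl"
definition comp22 :: "_ \<Rightarrow> 'y \<Rightarrow>\<^sub>L 'y" where "comp22 T = ms_snd o\<^sub>L T o\<^sub>L ms_inr"

lemmas comp_defs = comp11_def comp12_def comp21_def comp22_def

lemma comp_bounded_ops:
  assumes "T \<in> B"
  shows "comp11 T \<in> bounded_ops sX sX" "comp12 T \<in> bounded_ops sY sX"
    "comp21 T \<in> bounded_ops sX sY" "comp22 T \<in> bounded_ops sY sY"
  unfolding comp_defs using assms by (auto intro!: bounded_ops_compose)

lemma comp_compact:
  assumes "T \<in> K"
  shows "comp11 T \<in> compact_ops sX sX" "comp12 T \<in> compact_ops sY sX"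
    "comp21 T \<in> compact_ops sX sY" "comp22 T \<in> compact_ops sY sY"
  unfolding comp_defs
  by (intro compact_ops_compose_right[OF compact_ops_compose_left[OF _ assms]] structure_maps)+

lemma apply_comp:
  "blinfun_apply T (MS x y) =
    MS (blinfun_apply (comp11 T) x + blinfun_apply (comp12 T) y)
       (blinfun_apply (comp21 T) x + blinfun_apply (comp22 T) y)"
proof -
  have "MS x y = MS x 0 + MS 0 y"
    by (simp add: plus_maxsum_def)
  then have "blinfun_apply T (MS x y) = blinfun_apply T (MS x 0) + blinfun_apply T (MS 0 y)"
    by (simp add: blinfun.add_right)
  then show ?thesis
    by (simp add: comp_defs plus_maxsum_def)
qed

lemma comp21_compact:
  assumes T: "T \<in> B"
  shows "comp21 T \<in> compact_ops sX sY"
proof -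
  let ?S = "J o\<^sub>L comp21 T"
  have S: "?S \<in> bounded_ops sX sX"
    using bounded_ops_compose[OF J_op comp_bounded_ops(3)[OF T]] .
  then obtain c L where L: "L \<in> compact_ops sX sX" and eq: "\<And>x. blinfun_apply ?S x = sX c x + blinfun_apply L x"
    using few unfolding very_few_operators_def by blast
  have "c = 0"
  proof (rule ccontr)
    assume c: "c \<noteq> 0"
    \<comment> \<open>Solving \<open>J o\<^sub>L comp21 T = c I + L\<close> for the identity shows
      that \<open>x\<close> and \<open>L' x\<close> agree modulo the range of \<open>J\<close>. The
      image of the ball under \<open>L'\<close> thus represents the whole ball modulo that
      range.\<close>
    define L' where "L' = scalar_op sX (- inverse c) o\<^sub>L L"
    have "L' \<in> compact_ops sX sX"
      unfolding L'_def by (rule compact_ops_compose_left[OF scalar_op_bounded_ops[OF kX] L])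
    then have "totally_bounded (blinfun_apply L' ` cball 0 1)"
      by (simp add: compact_ops_iff)
    moreover have "\<exists>a\<in>blinfun_apply L' ` cball 0 1. x - a \<in> range (blinfun_apply J)"
      if "norm x \<le> 1" for x
    proof (rule bexI)
      have "x - blinfun_apply L' x = sX (inverse c) (blinfun_apply ?S x)"
        unfolding eq using c by (simp add: L'_def kX X.scale_right_distrib)
      also have "\<dots> = blinfun_apply J (sY (inverse c) (blinfun_apply (comp21 T) x))"
        by (simp add: bounded_opsD[OF J_op])
      finally show "x - blinfun_apply L' x \<in> range (blinfun_apply J)"
        by simp
    qed (use that in simp)
    moreover have "X.subspace (range (blinfun_apply J))"
      using module_hom.subspace_image[OF J_hom Y.subspace_UNIV] .
    ultimately have "\<exists>B. finite B \<and> X.span (range (blinfun_apply J) \<union> B) = UNIV"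
      by (intro X.finite_codim_if_ball_totally_bounded[OF _ closed_range_J])
    then show False
      using codim unfolding infinite_codim_def by blast
  qed
  then have "?S = L"
    by (intro blinfun_eqI) (simp add: eq del: blinfun_apply_blinfun_compose)
  then show ?thesis
    using compact_if_J_compact[OF comp_bounded_ops(3)[OF T]] L by simp
qed

lemma matrix_rep_exists:
  assumes T: "T \<in> B"
  obtains a11 a12 a22 where "matrix_rep sX sY J T a11 a12 a22"
proof -
  note op = comp_bounded_ops[OF T]
  obtain a11 K11 where 11: "K11 \<in> compact_ops sX sX"
    "\<And>x. blinfun_apply (comp11 T) x = sX a11 x + blinfun_apply K11 x"
    using few op(1) unfolding very_few_operators_def by blast
  obtain a12 K12 where 12: "K12 \<in> compact_ops sY sX"
    "\<And>y. blinfun_apply (comp12 T) y = sX a12 (blinfun_apply J y) + blinfun_apply K12 y"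
    using few_J[OF op(2)] by blast
  \<comment> \<open>The hypothesis concerns operators from \<open>Y\<close> to \<open>X\<close>, so
    it is applied after composing with \<open>J\<close>; the compact part is then pulled back to
    \<open>Y\<close>.\<close>
  obtain a22 L where L: "L \<in> compact_ops sY sX"
    "\<And>y. blinfun_apply (J o\<^sub>L comp22 T) y = sX a22 (blinfun_apply J y) + blinfun_apply L y"
    using few_J[OF bounded_ops_compose[OF J_op op(4)]] by blast
  define K22 where "K22 = comp22 T - scalar_op sY a22"
  have "J o\<^sub>L K22 = L"
    using L(2) by (intro blinfun_eqI)
      (simp add: K22_def blinfun.diff_left blinfun.diff_right kY bounded_opsD[OF J_op])
  then have 22: "K22 \<in> compact_ops sY sY"
    using compact_if_J_compact[of K22 sY] L(1) op(4) scalar_op_bounded_ops[OF kY]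
    by (simp add: K22_def bounded_ops_diff[OF kY])
  have "matrix_rep sX sY J T a11 a12 a22"
    unfolding matrix_rep_def
    by (rule bexI[OF _ 11(1)], rule bexI[OF _ 12(1)], rule bexI[OF _ comp21_compact[OF T]],
        rule bexI[OF _ 22])
      (simp add: apply_comp 11(2) 12(2) K22_def blinfun.diff_left kY)
  then show thesis
    by (rule that)
qed

text \<open>Lifts of the upper triangular matrix units. The off-diagonal one uses \<open>J\<close>,
  and a unit for the lower left corner is absent because every entry there is compact.\<close>

definition E11 :: "('x, 'y) maxsum \<Rightarrow>\<^sub>L ('x, 'y) maxsum" where "E11 = ms_inl o\<^sub>L ms_fst"
definition E12 :: "('x, 'y) maxsum \<Rightarrow>\<^sub>L ('x, 'y) maxsum" where "E12 = ms_inl o\<^sub>L J o\<^sub>L ms_snd"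
definition E22 :: "('x, 'y) maxsum \<Rightarrow>\<^sub>L ('x, 'y) maxsum" where "E22 = ms_inr o\<^sub>L ms_snd"

lemmas E_defs = E11_def E12_def E22_def

lemma E_bounded_ops: "E11 \<in> B" "E12 \<in> B" "E22 \<in> B"
  unfolding E_defs by (auto intro!: bounded_ops_compose J_op)

lemma E_mult: "E11 o\<^sub>L E12 = E12" "E12 o\<^sub>L E22 = E12"
  by (auto intro!: blinfun_eqI simp: E_defs)

abbreviation scal :: "'k \<Rightarrow> _" where "scal \<equiv> scalar_op sZ"

lemma scal_bounded_ops: "scal c \<in> B"
  by (rule scalar_op_bounded_ops[OF kZ])

lemma matrix_rep_decomp:
  assumes "matrix_rep sX sY J T a11 a12 a22"
  obtains L where "L \<in> K"
    "T = (scal a11 o\<^sub>L E11) + (scal a12 o\<^sub>L E12) + (scal a22 o\<^sub>L E22) + L"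
proof -
  obtain K11 K12 K21 K22 where c: "K11 \<in> compact_ops sX sX" "K12 \<in> compact_ops sY sX"
      "K21 \<in> compact_ops sX sY" "K22 \<in> compact_ops sY sY"
    and T: "\<And>x y. blinfun_apply T (MS x y) =
          MS ((sX a11 x + blinfun_apply K11 x) + (sX a12 (blinfun_apply J y) + blinfun_apply K12 y))
             (blinfun_apply K21 x + (sY a22 y + blinfun_apply K22 y))"
    using assms unfolding matrix_rep_def by blast
  define L where "L = (ms_inl o\<^sub>L (K11 o\<^sub>L ms_fst)) + (ms_inl o\<^sub>L (K12 o\<^sub>L ms_snd)) +
    (ms_inr o\<^sub>L (K21 o\<^sub>L ms_fst)) + (ms_inr o\<^sub>L (K22 o\<^sub>L ms_snd))"
  show thesis
  proof
    show "L \<in> K"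
      unfolding L_def using c
      by (intro compact_ops_add[OF kZ] compact_ops_compose_left[OF structure_maps(1)]
          compact_ops_compose_left[OF structure_maps(2)]
          compact_ops_compose_right[OF _ structure_maps(3)]
          compact_ops_compose_right[OF _ structure_maps(4)])
    show "T = (scal a11 o\<^sub>L E11) + (scal a12 o\<^sub>L E12) + (scal a22 o\<^sub>L E22) + L"
    proof (rule blinfun_eqI)
      fix z
      show "blinfun_apply T z =
        blinfun_apply ((scal a11 o\<^sub>L E11) + (scal a12 o\<^sub>L E12) + (scal a22 o\<^sub>L E22) + L) z"
        by (cases z)
          (simp add: T L_def E_defs kZ blinfun.add_left plus_maxsum_def ms_scale_def)
    qed
  qed
qed

lemma matrix_rep_compact_diff:
  assumes "matrix_rep sX sY J T a11 a12 a22"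
  shows "comp11 T - scalar_op sX a11 \<in> compact_ops sX sX"
    and "comp22 T - scalar_op sY a22 \<in> compact_ops sY sY"
proof -
  obtain K11 K12 K21 K22 where c: "K11 \<in> compact_ops sX sX" "K22 \<in> compact_ops sY sY"
    and T: "\<And>x y. blinfun_apply T (MS x y) =
          MS ((sX a11 x + blinfun_apply K11 x) + (sX a12 (blinfun_apply J y) + blinfun_apply K12 y))
             (blinfun_apply K21 x + (sY a22 y + blinfun_apply K22 y))"
    using assms unfolding matrix_rep_def by blast
  have "comp11 T - scalar_op sX a11 = K11" "comp22 T - scalar_op sY a22 = K22"
    by (auto intro!: blinfun_eqI simp: comp_defs T blinfun.diff_left kX kY)
  then show "comp11 T - scalar_op sX a11 \<in> compact_ops sX sX"
    "comp22 T - scalar_op sY a22 \<in> compact_ops sY sY"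
    using c by auto
qed

lemma scalar_unique:
  assumes s: "kbanach s" "infinite_dim s"
    and "T - scalar_op s a \<in> compact_ops s s" "T - scalar_op s a' \<in> compact_ops s s"
  shows "a = a'"
proof (rule ccontr)
  interpret s: kbanach s by fact
  assume "a \<noteq> a'"
  have "(T - scalar_op s a') - (T - scalar_op s a) = scalar_op s (a - a')"
    by (rule blinfun_eqI) (simp add: blinfun.diff_left s s.scale_left_diff_distrib)
  then have "scalar_op s (a - a') \<in> compact_ops s s"
    using compact_ops_diff[OF s(1) assms(4,3)] by metis
  then show False
    using scalar_op_not_compact[OF s] \<open>a \<noteq> a'\<close> by auto
qed

text \<open>Two scalars representing the same diagonal entry differ by a compact scalar operator,
  which must be 0 in infinite dimension. This justifies the definite descriptions behind
  \<open>alpha11\<close> and \<open>alpha22\<close>.\<close>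

lemma alpha_eq:
  assumes "matrix_rep sX sY J T a11 a12 a22"
  shows "alpha11 sX sY J T = a11" "alpha22 sX sY J T = a22"
proof -
  note diff = matrix_rep_compact_diff[OF assms]
  show "alpha11 sX sY J T = a11"
    unfolding alpha11_def
  proof (rule the_equality)
    show "a = a11" if "\<exists>a12 a22. matrix_rep sX sY J T a a12 a22" for a
      using that scalar_unique[OF kX X_infinite_dim _ diff(1)] matrix_rep_compact_diff(1) by blast
  qed (use assms in blast)
  show "alpha22 sX sY J T = a22"
    unfolding alpha22_def
  proof (rule the_equality)
    show "a = a22" if "\<exists>a11 a12. matrix_rep sX sY J T a11 a12 a" for a
      using that scalar_unique[OF kY Y_infinite_dim _ diff(2)] matrix_rep_compact_diff(2) by blast
  qed (use assms in blast)
qed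

lemma compact_iff_scalar_zero:
  assumes s: "kbanach s" "infinite_dim s" and T: "T - scalar_op s a \<in> compact_ops s s"
  shows "T \<in> compact_ops s s \<longleftrightarrow> a = 0"
proof -
  interpret s: kbanach s by fact
  have "scalar_op s 0 = 0"
    by (rule blinfun_eqI) (simp add: s)
  then show ?thesis
    using scalar_unique[OF s T, of 0] T by auto
qed

text \<open>Replaces the chosen scalar by a condition on an entry that depends linearly and
  continuously on \<open>T\<close>, from which the ideal property and closedness are read
  off.\<close>

lemma M1_eq: "M1 sX sY J = {T \<in> B. comp22 T \<in> compact_ops sY sY}"
proof -
  have "alpha22 sX sY J T = 0 \<longleftrightarrow> comp22 T \<in> compact_ops sY sY" if "T \<in> B" for T
    using matrix_rep_exists[OF that]
    by (metis alpha_eq(2) compact_iff_scalar_zero[OF kY Y_infinite_dim] matrix_rep_compact_diff(2))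
  then show ?thesis
    unfolding M1_def by blast
qed

lemma M2_eq: "M2 sX sY J = {T \<in> B. comp11 T \<in> compact_ops sX sX}"
proof -
  have "alpha11 sX sY J T = 0 \<longleftrightarrow> comp11 T \<in> compact_ops sX sX" if "T \<in> B" for T
    using matrix_rep_exists[OF that]
    by (metis alpha_eq(1) compact_iff_scalar_zero[OF kX X_infinite_dim] matrix_rep_compact_diff(1))
  then show ?thesis
    unfolding M2_def by blast
qed

lemma comp_add: "comp11 (S + T) = comp11 S + comp11 T" "comp22 (S + T) = comp22 S + comp22 T"
  by (auto intro!: blinfun_eqI simp: comp_defs blinfun.add_left)

lemma comp_compose:
  "comp11 (S o\<^sub>L T) = (comp11 S o\<^sub>L comp11 T) + (comp12 S o\<^sub>L comp21 T)"
  "comp22 (S o\<^sub>L T) = (comp21 S o\<^sub>L comp12 T) + (comp22 S o\<^sub>L comp22 T)"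
proof -
  have "blinfun_apply T z = MS (ms1 (blinfun_apply T z)) (ms2 (blinfun_apply T z))" for z
    by simp
  then have "blinfun_apply S (blinfun_apply T z) =
      MS (blinfun_apply (comp11 S) (ms1 (blinfun_apply T z)) +
          blinfun_apply (comp12 S) (ms2 (blinfun_apply T z)))
         (blinfun_apply (comp21 S) (ms1 (blinfun_apply T z)) +
          blinfun_apply (comp22 S) (ms2 (blinfun_apply T z)))" for z
    by (metis apply_comp)
  then have *: "ms1 (blinfun_apply S (blinfun_apply T z)) =
      blinfun_apply (comp11 S) (ms1 (blinfun_apply T z)) +
      blinfun_apply (comp12 S) (ms2 (blinfun_apply T z))"
    "ms2 (blinfun_apply S (blinfun_apply T z)) =
      blinfun_apply (comp21 S) (ms1 (blinfun_apply T z)) +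
      blinfun_apply (comp22 S) (ms2 (blinfun_apply T z))" for z
    by simp_all
  show "comp11 (S o\<^sub>L T) = (comp11 S o\<^sub>L comp11 T) + (comp12 S o\<^sub>L comp21 T)"
    by (rule blinfun_eqI) (simp add: comp11_def[of "S o\<^sub>L T"] * blinfun.add_left
        comp11_def[of T] comp21_def[of T])
  show "comp22 (S o\<^sub>L T) = (comp21 S o\<^sub>L comp12 T) + (comp22 S o\<^sub>L comp22 T)"
    by (rule blinfun_eqI) (simp add: comp22_def[of "S o\<^sub>L T"] * blinfun.add_left
        comp22_def[of T] comp12_def[of T])
qed

text \<open>In a product, the mixed term of each diagonal entry contains a lower left entry and is
  therefore compact. Modulo compact operators the diagonal entries thus multiply separately.\<close>

lemma comp_compose_compact:
  assumes "S \<in> B" "T \<in> B"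
  shows "comp11 S \<in> compact_ops sX sX \<or> comp11 T \<in> compact_ops sX sX \<Longrightarrow>
      comp11 (S o\<^sub>L T) \<in> compact_ops sX sX"
    and "comp22 S \<in> compact_ops sY sY \<or> comp22 T \<in> compact_ops sY sY \<Longrightarrow>
      comp22 (S o\<^sub>L T) \<in> compact_ops sY sY"
proof -
  note S = comp_bounded_ops[OF assms(1)] comp21_compact[OF assms(1)]
    and T = comp_bounded_ops[OF assms(2)] comp21_compact[OF assms(2)]
  show "comp11 (S o\<^sub>L T) \<in> compact_ops sX sX"
    if "comp11 S \<in> compact_ops sX sX \<or> comp11 T \<in> compact_ops sX sX"
    unfolding comp_compose
  proof (rule compact_ops_add[OF kX])
    show "comp11 S o\<^sub>L comp11 T \<in> compact_ops sX sX"
      using that compact_ops_compose_left[OF S(1)] compact_ops_compose_right[OF _ T(1)] by auto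
    show "comp12 S o\<^sub>L comp21 T \<in> compact_ops sX sX"
      by (rule compact_ops_compose_left[OF S(2) T(5)])
  qed
  show "comp22 (S o\<^sub>L T) \<in> compact_ops sY sY"
    if "comp22 S \<in> compact_ops sY sY \<or> comp22 T \<in> compact_ops sY sY"
    unfolding comp_compose
  proof (rule compact_ops_add[OF kY])
    show "comp21 S o\<^sub>L comp12 T \<in> compact_ops sY sY"
      by (rule compact_ops_compose_right[OF S(5) T(2)])
    show "comp22 S o\<^sub>L comp22 T \<in> compact_ops sY sY"
      using that compact_ops_compose_left[OF S(4)] compact_ops_compose_right[OF _ T(4)] by auto
  qed
qed

lemma ideal_M1: "ideal (M1 sX sY J) (op_ring sZ)"
  unfolding M1_eq
proof (rule ideal_op_ringI[OF kZ])
  show "0 \<in> {T \<in> B. comp22 T \<in> compact_ops sY sY}"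
    using bounded_ops_zero[OF kZ] comp_compact(4)[OF compact_ops_zero[OF kZ]] by simp
qed (auto simp: comp_add comp_compose_compact
    intro: bounded_ops_add[OF kZ] bounded_ops_compose compact_ops_add[OF kY])

lemma ideal_M2: "ideal (M2 sX sY J) (op_ring sZ)"
  unfolding M2_eq
proof (rule ideal_op_ringI[OF kZ])
  show "0 \<in> {T \<in> B. comp11 T \<in> compact_ops sX sX}"
    using bounded_ops_zero[OF kZ] comp_compact(1)[OF compact_ops_zero[OF kZ]] by simp
qed (auto simp: comp_add comp_compose_compact
    intro: bounded_ops_add[OF kZ] bounded_ops_compose compact_ops_add[OF kX])

lemma closed_M1: "closed (M1 sX sY J)"
proof -
  have "M1 sX sY J = B \<inter> comp22 -` compact_ops sY sY"
    by (auto simp: M1_eq)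
  moreover have "closed (comp22 -` compact_ops sY sY)"
    unfolding comp22_def
    by (intro closed_vimage closed_compact_ops[OF kY] bounded_bilinear.continuous_on[OF
          bounded_bilinear_blinfun_compose] continuous_on_id continuous_on_const)
  ultimately show ?thesis
    using closed_bounded_ops[OF kZ] by auto
qed

lemma closed_M2: "closed (M2 sX sY J)"
proof -
  have "M2 sX sY J = B \<inter> comp11 -` compact_ops sX sX"
    by (auto simp: M2_eq)
  moreover have "closed (comp11 -` compact_ops sX sX)"
    unfolding comp11_def
    by (intro closed_vimage closed_compact_ops[OF kX] bounded_bilinear.continuous_on[OF
          bounded_bilinear_blinfun_compose] continuous_on_id continuous_on_const)
  ultimately show ?thesis
    using closed_bounded_ops[OF kZ] by auto
qed

lemma E_comp:
  "comp11 E11 = scalar_op sX 1" "comp22 E11 = 0"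
  "comp11 E12 = 0" "comp12 E12 = J" "comp22 E12 = 0"
  "comp11 E22 = 0" "comp22 E22 = scalar_op sY 1"
  by (rule blinfun_eqI, simp add: comp_defs E_defs kX kY)+

lemma J_not_compact: "J \<notin> compact_ops sY sX"
proof
  assume "J \<in> compact_ops sY sX"
  then have "totally_bounded (cball (0::'y) 1)"
    by (intro totally_bounded_isometric_preimage[OF dist_J]) (simp add: compact_ops_iff)
  then show False
    using Y.ball_not_totally_bounded[OF Y_infinite_dim] by blast
qed

text \<open>The matrix units witness that the inclusions above the compact operators are proper and
  that \<open>M1\<close> and \<open>M2\<close> are incomparable.\<close>

lemma E_mem:
  "E11 \<in> M1 sX sY J" "E11 \<notin> M2 sX sY J"
  "E12 \<in> M1 sX sY J" "E12 \<in> M2 sX sY J" "E12 \<notin> K"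
  "E22 \<notin> M1 sX sY J" "E22 \<in> M2 sX sY J"
  using comp_compact(2)[of E12] J_not_compact
    scalar_op_not_compact[OF kX X_infinite_dim, of 1] scalar_op_not_compact[OF kY Y_infinite_dim, of 1]
  by (auto simp: M1_eq M2_eq E_bounded_ops E_comp compact_ops_zero kX kY)

section \<open>Classification of the ideals above the compact operators\<close>

context
  fixes I
  assumes I: "ideal I (op_ring sZ)" and KI: "K \<subseteq> I"
begin

lemma I_ops:
  "S \<in> I \<Longrightarrow> T \<in> I \<Longrightarrow> S + T \<in> I"
  "A \<in> B \<Longrightarrow> T \<in> I \<Longrightarrow> A o\<^sub>L T \<in> I"
  "A \<in> B \<Longrightarrow> T \<in> I \<Longrightarrow> T o\<^sub>L A \<in> I"
  using additive_subgroup.a_closed[OF ideal.axioms(1)[OF I]]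
    ideal.I_l_closed[OF I] ideal.I_r_closed[OF I]
  by (simp_all add: op_ring_def)

text \<open>Used to extract a matrix unit \<open>V\<close> once some element of the ideal is a
  nonzero multiple of it up to a compact operator.\<close>

lemma cancel_scal:
  assumes U: "U \<in> I" "U - (scal c o\<^sub>L V) \<in> K" and c: "c \<noteq> 0"
  shows "V \<in> I"
proof -
  interpret Z: kbanach sZ by (rule kZ)
  have "- (U - (scal c o\<^sub>L V)) \<in> I"
    using compact_ops_uminus[OF kZ U(2)] KI by blast
  then have "scal (inverse c) o\<^sub>L (U + - (U - (scal c o\<^sub>L V))) \<in> I"
    using U(1) by (intro I_ops scal_bounded_ops)
  moreover have "scal (inverse c) o\<^sub>L (U + - (U - (scal c o\<^sub>L V))) = V"
    using c by (intro blinfun_eqI) (simp add: kZ)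
  ultimately show ?thesis
    by simp
qed

lemma E22_mem:
  assumes "T \<in> I" "T \<notin> M1 sX sY J"
  shows "E22 \<in> I"
proof -
  have T: "T \<in> B"
    using ideal.Icarr[OF I assms(1)] by (simp add: op_ring_def)
  obtain a11 a12 a22 where rep: "matrix_rep sX sY J T a11 a12 a22"
    using matrix_rep_exists[OF T] .
  have a22: "a22 \<noteq> 0"
    using assms(2) T alpha_eq(2)[OF rep] by (auto simp: M1_def)
  \<comment> \<open>Compressing by \<open>E22\<close> on both sides keeps only the lower right
    entry, which is \<open>a22\<close> up to a compact operator.\<close>
  have "(E22 o\<^sub>L T o\<^sub>L E22) - (scal a22 o\<^sub>L E22)
      = ms_inr o\<^sub>L ((comp22 T - scalar_op sY a22) o\<^sub>L ms_snd)"
    by (rule blinfun_eqI)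
      (simp add: E_defs comp_defs kZ kY ms_scale_def blinfun.diff_left minus_maxsum_def)
  also have "\<dots> \<in> K"
    by (rule compact_ops_compose_left[OF structure_maps(2)
          compact_ops_compose_right[OF matrix_rep_compact_diff(2)[OF rep] structure_maps(4)]])
  finally show ?thesis
    by (rule cancel_scal[OF I_ops(3)[OF E_bounded_ops(3) I_ops(2)[OF E_bounded_ops(3) assms(1)]] _ a22])
qed

lemma E11_mem:
  assumes "T \<in> I" "T \<notin> M2 sX sY J"
  shows "E11 \<in> I"
proof -
  have T: "T \<in> B"
    using ideal.Icarr[OF I assms(1)] by (simp add: op_ring_def)
  obtain a11 a12 a22 where rep: "matrix_rep sX sY J T a11 a12 a22"
    using matrix_rep_exists[OF T] .
  have a11: "a11 \<noteq> 0"
    using assms(2) T alpha_eq(1)[OF rep] by (auto simp: M2_def)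
  have "(E11 o\<^sub>L T o\<^sub>L E11) - (scal a11 o\<^sub>L E11)
      = ms_inl o\<^sub>L ((comp11 T - scalar_op sX a11) o\<^sub>L ms_fst)"
    by (rule blinfun_eqI)
      (simp add: E_defs comp_defs kZ kX ms_scale_def blinfun.diff_left minus_maxsum_def)
  also have "\<dots> \<in> K"
    by (rule compact_ops_compose_left[OF structure_maps(1)
          compact_ops_compose_right[OF matrix_rep_compact_diff(1)[OF rep] structure_maps(3)]])
  finally show ?thesis
    by (rule cancel_scal[OF I_ops(3)[OF E_bounded_ops(1) I_ops(2)[OF E_bounded_ops(1) assms(1)]] _ a11])
qed

text \<open>A noncompact \<open>T\<close> with vanishing diagonal scalars must have a nonzero
  off-diagonal scalar. Otherwise a diagonal unit lies in \<open>I\<close>, and multiplying it by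
  \<open>E12\<close> on the suitable side gives \<open>E12\<close>.\<close>

lemma E12_mem:
  assumes "T \<in> I" "T \<notin> K"
  shows "E12 \<in> I"
proof (cases "T \<in> M1 sX sY J \<and> T \<in> M2 sX sY J")
  case True
  then have T: "T \<in> B"
    by (simp add: M1_def)
  obtain a11 a12 a22 where rep: "matrix_rep sX sY J T a11 a12 a22"
    using matrix_rep_exists[OF T] .
  have a: "a11 = 0" "a22 = 0"
    using True alpha_eq[OF rep] by (auto simp: M1_def M2_def)
  obtain L where L: "L \<in> K"
    "T = (scal a11 o\<^sub>L E11) + (scal a12 o\<^sub>L E12) + (scal a22 o\<^sub>L E22) + L"
    using matrix_rep_decomp[OF rep] .
  interpret Z: kbanach sZ by (rule kZ)
  have "scal 0 = 0"
    by (rule blinfun_eqI) (simp add: kZ)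
  then have T_eq: "T = (scal a12 o\<^sub>L E12) + L"
    using L(2) a by simp
  show ?thesis
  proof (rule cancel_scal[OF assms(1)])
    show "T - (scal a12 o\<^sub>L E12) \<in> K"
      using T_eq L(1) by simp
    show "a12 \<noteq> 0"
      using T_eq L(1) assms(2) \<open>scal 0 = 0\<close> by auto
  qed
next
  case False
  then have "E11 \<in> I \<or> E22 \<in> I"
    using E11_mem E22_mem assms(1) by blast
  then show ?thesis
    using I_ops(2)[OF E_bounded_ops(2), of E22] I_ops(3)[OF E_bounded_ops(2), of E11] E_mult by auto
qed

text \<open>\<open>T\<close> is a combination of matrix units plus a compact operator. A diagonal
  unit is needed only when its coefficient is nonzero, which is what the conditional assumptions
  express.\<close>

lemma ideal_contains:
  assumes "T \<in> B" "E12 \<in> I" "T \<notin> M1 sX sY J \<Longrightarrow> E22 \<in> I" "T \<notin> M2 sX sY J \<Longrightarrow> E11 \<in> I"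
  shows "T \<in> I"
proof -
  obtain a11 a12 a22 where rep: "matrix_rep sX sY J T a11 a12 a22"
    using matrix_rep_exists[OF assms(1)] .
  obtain L where L: "L \<in> K"
    "T = (scal a11 o\<^sub>L E11) + (scal a12 o\<^sub>L E12) + (scal a22 o\<^sub>L E22) + L"
    using matrix_rep_decomp[OF rep] .
  interpret Z: kbanach sZ by (rule kZ)
  have zero: "0 \<in> I" "scal 0 = 0"
    using KI compact_ops_zero[OF kZ] by (auto intro!: blinfun_eqI simp: kZ)
  have "scal a11 o\<^sub>L E11 \<in> I"
    using assms(1,4) alpha_eq(1)[OF rep] zero I_ops(2)[OF scal_bounded_ops]
    by (cases "a11 = 0") (auto simp: M2_def)
  moreover have "scal a22 o\<^sub>L E22 \<in> I"
    using assms(1,3) alpha_eq(2)[OF rep] zero I_ops(2)[OF scal_bounded_ops]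
    by (cases "a22 = 0") (auto simp: M1_def)
  ultimately show ?thesis
    unfolding L(2) using L(1) KI I_ops(2)[OF scal_bounded_ops assms(2)] by (blast intro: I_ops(1))
qed

text \<open>Beyond \<open>K\<close> the unit \<open>E12\<close> is always present, so the ideal is
  determined by which diagonal units it contains, that is, by whether it leaves \<open>M1\<close>
  and whether it leaves \<open>M2\<close>.\<close>

lemma ideal_cases: "I \<in> {K, M1 sX sY J \<inter> M2 sX sY J, M1 sX sY J, M2 sX sY J, B}"
proof -
  have IB: "I \<subseteq> B"
    using ideal.Icarr[OF I] by (auto simp: op_ring_def)
  have MB: "M1 sX sY J \<subseteq> B" "M2 sX sY J \<subseteq> B"
    by (auto simp: M1_def M2_def)
  show ?thesis
  proof (cases "I \<subseteq> K")
    case True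
    then show ?thesis
      using KI by blast
  next
    case False
    then have "E12 \<in> I"
      using E12_mem by blast
    note c = ideal_contains[OF _ this]
    show ?thesis
    proof (cases "I \<subseteq> M1 sX sY J")
      case True
      show ?thesis
      proof (cases "I \<subseteq> M2 sX sY J")
        case True
        then have "I = M1 sX sY J \<inter> M2 sX sY J"
          using \<open>I \<subseteq> M1 sX sY J\<close> c MB by blast
        then show ?thesis by blast
      next
        case False
        then have "I = M1 sX sY J"
          using \<open>I \<subseteq> M1 sX sY J\<close> c MB E11_mem by blast
        then show ?thesis by blast
      qed
    next
      case False
      then have E22: "E22 \<in> I"
        using E22_mem by blast
      show ?thesis
      proof (cases "I \<subseteq> M2 sX sY J")
        case True
        then have "I = M2 sX sY J"
          using E22 c MB by blast
        then show ?thesis by blast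
      next
        case False
        then have "I = B"
          using E22 E11_mem c IB by blast
        then show ?thesis by blast
      qed
    qed
  qed
qed

end

lemma K_subset: "K \<subseteq> M1 sX sY J \<inter> M2 sX sY J"
  using comp_compact compact_imp_bounded_op unfolding M1_eq M2_eq by blast

lemma ideal_Int: "ideal (M1 sX sY J \<inter> M2 sX sY J) (op_ring sZ)"
  by (intro ring.i_intersect ring_op_ring kZ ideal_M1 ideal_M2)

lemma ideal_B: "ideal B (op_ring sZ)"
  using ring.oneideal[OF ring_op_ring[OF kZ]] by (simp add: op_ring_def)

lemma closed_ideals_eq:
  assumes "bounded_approximation sZ R C"
  shows "closed_ideals sZ = {{0}, K, M1 sX sY J \<inter> M2 sX sY J, M1 sX sY J, M2 sX sY J, B}"
proof
  interpret A: bounded_approximation sZ R C by fact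
  show "closed_ideals sZ \<subseteq> {{0}, K, M1 sX sY J \<inter> M2 sX sY J, M1 sX sY J, M2 sX sY J, B}"
    using A.nonzero_closed_ideal_contains_compact ideal_cases unfolding closed_ideals_def by blast
  have "ideal {0} (op_ring sZ)"
    using ring.zeroideal[OF ring_op_ring[OF kZ]] by (simp add: op_ring_def)
  then show "{{0}, K, M1 sX sY J \<inter> M2 sX sY J, M1 sX sY J, M2 sX sY J, B} \<subseteq> closed_ideals sZ"
    using ideal_M1 ideal_M2 ideal_Int ideal_B ideal_compact_ops[OF kZ] closed_M1 closed_M2
      closed_bounded_ops[OF kZ] closed_compact_ops[OF kZ]
    by (auto simp: closed_ideals_def)
qed

section \<open>The inessential operators\<close>

lemma scalar_mod_M1:
  assumes T: "T \<in> B" "T \<notin> M1 sX sY J"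
  shows "\<exists>A\<in>B. id_blinfun - (A o\<^sub>L T) \<in> M1 sX sY J"
proof -
  obtain a11 a12 a22 where rep: "matrix_rep sX sY J T a11 a12 a22"
    using matrix_rep_exists[OF T(1)] .
  have a22: "a22 \<noteq> 0"
    using T alpha_eq(2)[OF rep] by (auto simp: M1_def)
  \<comment> \<open>Modulo \<open>M1\<close> the operator \<open>T\<close> is the scalar
    \<open>a22\<close>, so its inverse scalar is a left inverse there. The next lemma does the same
    for \<open>M2\<close> with \<open>a11\<close>.\<close>
  have "comp22 (id_blinfun - (scal (inverse a22) o\<^sub>L T))
      = scalar_op sY (- inverse a22) o\<^sub>L (comp22 T - scalar_op sY a22)"
    using a22
    by (intro blinfun_eqI)
      (simp add: comp_defs kZ kY ms_scale_def blinfun.diff_left Y.scale_right_diff_distrib)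
  also have "\<dots> \<in> compact_ops sY sY"
    by (rule compact_ops_compose_left[OF scalar_op_bounded_ops[OF kY] matrix_rep_compact_diff(2)[OF rep]])
  finally have "id_blinfun - (scal (inverse a22) o\<^sub>L T) \<in> M1 sX sY J"
    using T(1) by (auto simp: M1_eq intro!: bounded_ops_diff[OF kZ] bounded_ops_compose
        id_bounded_ops scal_bounded_ops)
  then show ?thesis
    using scal_bounded_ops by blast
qed

lemma scalar_mod_M2:
  assumes T: "T \<in> B" "T \<notin> M2 sX sY J"
  shows "\<exists>A\<in>B. id_blinfun - (A o\<^sub>L T) \<in> M2 sX sY J"
proof -
  obtain a11 a12 a22 where rep: "matrix_rep sX sY J T a11 a12 a22"
    using matrix_rep_exists[OF T(1)] .
  have a11: "a11 \<noteq> 0"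
    using T alpha_eq(1)[OF rep] by (auto simp: M2_def)
  have "comp11 (id_blinfun - (scal (inverse a11) o\<^sub>L T))
      = scalar_op sX (- inverse a11) o\<^sub>L (comp11 T - scalar_op sX a11)"
    using a11
    by (intro blinfun_eqI)
      (simp add: comp_defs kZ kX ms_scale_def blinfun.diff_left X.scale_right_diff_distrib)
  also have "\<dots> \<in> compact_ops sX sX"
    by (rule compact_ops_compose_left[OF scalar_op_bounded_ops[OF kX] matrix_rep_compact_diff(1)[OF rep]])
  finally have "id_blinfun - (scal (inverse a11) o\<^sub>L T) \<in> M2 sX sY J"
    using T(1) by (auto simp: M2_eq intro!: bounded_ops_diff[OF kZ] bounded_ops_compose
        id_bounded_ops scal_bounded_ops)
  then show ?thesis
    using scal_bounded_ops by blast
qed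

text \<open>Such an \<open>S\<close> is a multiple \<open>N\<close> of \<open>E12\<close> plus a
  compact \<open>L\<close>. The square of \<open>N\<close> vanishes since \<open>E12\<close> maps
  into the first summand and annihilates it; all other terms contain \<open>L\<close>.\<close>

lemma square_compact:
  assumes S: "S \<in> M1 sX sY J \<inter> M2 sX sY J"
  shows "S o\<^sub>L S \<in> K"
proof -
  have SB: "S \<in> B"
    using S by (simp add: M1_def)
  obtain a11 a12 a22 where rep: "matrix_rep sX sY J S a11 a12 a22"
    using matrix_rep_exists[OF SB] .
  have a: "a11 = 0" "a22 = 0"
    using S alpha_eq[OF rep] by (auto simp: M1_def M2_def)
  obtain L where L: "L \<in> K"
    "S = (scal a11 o\<^sub>L E11) + (scal a12 o\<^sub>L E12) + (scal a22 o\<^sub>L E22) + L"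
    using matrix_rep_decomp[OF rep] .
  interpret Z: kbanach sZ by (rule kZ)
  define N where "N = scal a12 o\<^sub>L E12"
  have "scal 0 = 0"
    by (rule blinfun_eqI) (simp add: kZ)
  then have S_eq: "S = N + L"
    using L(2) a by (simp add: N_def)
  have N_op: "N \<in> B"
    unfolding N_def by (rule bounded_ops_compose[OF scal_bounded_ops E_bounded_ops(2)])
  have N_sq: "N o\<^sub>L N = 0"
    by (rule blinfun_eqI) (simp add: N_def E_defs kZ ms_scale_def zero_maxsum_def)
  have "S o\<^sub>L S = (N o\<^sub>L N) + (N o\<^sub>L L) + (L o\<^sub>L S)"
    by (rule blinfun_eqI) (simp add: S_eq blinfun.add_left blinfun.add_right)
  also have "\<dots> \<in> K"
    unfolding N_sq using compact_ops_compose_left[OF N_op L(1)] compact_ops_compose_right[OF L(1) SB]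
    by (simp add: compact_ops_add[OF kZ])
  finally show ?thesis .
qed

lemma inessential_ops_eq:
  assumes "bounded_approximation sZ R C"
  shows "inessential_ops sZ = M1 sX sY J \<inter> M2 sX sY J"
proof -
  interpret A: bounded_approximation sZ R C by fact
  interpret K: ideal K "op_ring sZ"
    by (rule ideal_compact_ops[OF kZ])
  have minus: "S \<ominus>\<^bsub>op_ring sZ\<^esub> T = S - T" if "S \<in> B" "T \<in> B" for S T
  proof -
    have "\<ominus>\<^bsub>op_ring sZ\<^esub> T = - T"
      using that bounded_ops_uminus[OF kZ] by (intro K.minus_equality) (auto simp: op_ring_def)
    then show ?thesis
      by (simp add: a_minus_def op_ring_def)
  qed
  have eq: "inessential_ops sZ = {T \<in> B. K +>\<^bsub>op_ring sZ\<^esub> T \<in> jacobson_radical (op_ring sZ Quot K)}"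
    by (simp add: inessential_ops_def A.closure_finite_rank_ops Let_def)
  \<comment> \<open>Isolates what \<open>M1\<close> and \<open>M2\<close> share: a proper ideal
    above \<open>K\<close> modulo which every operator outside it has a left inverse contains all
    inessential operators.\<close>
  have le: "T \<in> M" if "T \<in> inessential_ops sZ" "ideal M (op_ring sZ)" "K \<subseteq> M" "M \<noteq> B"
    and inv: "\<And>T. T \<in> B \<Longrightarrow> T \<notin> M \<Longrightarrow> \<exists>A\<in>B. id_blinfun - (A o\<^sub>L T) \<in> M" for T M
  proof (rule K.jacobson_radical_quot_le[OF that(2,3)])
    show "\<exists>r\<in>carrier (op_ring sZ). \<one>\<^bsub>op_ring sZ\<^esub> \<ominus>\<^bsub>op_ring sZ\<^esub> r \<otimes>\<^bsub>op_ring sZ\<^esub> x \<in> M"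
      if x: "x \<in> carrier (op_ring sZ)" "x \<notin> M" for x
    proof -
      have xB: "x \<in> B"
        using x(1) by (simp add: op_ring_def)
      obtain A where A: "A \<in> B" "id_blinfun - (A o\<^sub>L x) \<in> M"
        using inv[OF xB x(2)] by blast
      then show ?thesis
        using minus[OF id_bounded_ops bounded_ops_compose[OF A(1) xB]]
        by (intro bexI[of _ A]) (simp_all add: op_ring_def)
    qed
  qed (use that in \<open>auto simp: eq op_ring_def\<close>)
  show ?thesis
  proof
    show "inessential_ops sZ \<subseteq> M1 sX sY J \<inter> M2 sX sY J"
      using le[OF _ ideal_M1] le[OF _ ideal_M2] K_subset E_mem E_bounded_ops
        scalar_mod_M1 scalar_mod_M2 by blast
    show "M1 sX sY J \<inter> M2 sX sY J \<subseteq> inessential_ops sZ"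
    proof
      fix T assume T: "T \<in> M1 sX sY J \<inter> M2 sX sY J"
      then have TB: "T \<in> B"
        by (simp add: M1_def)
      have "K +>\<^bsub>op_ring sZ\<^esub> T \<in> jacobson_radical (op_ring sZ Quot K)"
      \<comment> \<open>Left multiples of \<open>T\<close> stay in the ideal
        \<open>M1 \<inter> M2\<close>, so \<open>square_compact\<close> applies to each of
        them.\<close>
      proof (rule K.rcos_in_jacobson_radicalI)
        fix A assume "A \<in> carrier (op_ring sZ)"
        then have "A \<otimes>\<^bsub>op_ring sZ\<^esub> T \<in> M1 sX sY J \<inter> M2 sX sY J"
          using ideal.I_l_closed[OF ideal_Int T] by blast
        then show "(A \<otimes>\<^bsub>op_ring sZ\<^esub> T) \<otimes>\<^bsub>op_ring sZ\<^esub> (A \<otimes>\<^bsub>op_ring sZ\<^esub> T) \<in> K"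
          using square_compact by (simp add: op_ring_def)
      qed (use TB in \<open>simp add: op_ring_def\<close>)
      then show "T \<in> inessential_ops sZ"
        using TB by (simp add: eq)
    qed
  qed
qed

end

section \<open>The lattice of closed ideals\<close>

lemma card_six_sets:
  assumes "Z \<subset> K" "K \<subset> E" "E \<subset> A" "A \<subset> C" "E \<subset> B" "B \<subset> C" "\<not> A \<subseteq> B" "\<not> B \<subseteq> A"
  shows "card {Z, K, E, A, B, C} = 6"
proof -
  have "Z \<subset> E" "Z \<subset> A" "Z \<subset> B" "Z \<subset> C" "K \<subset> A" "K \<subset> B" "K \<subset> C" "E \<subset> C" "A \<noteq> B"
    using assms by (blast intro: psubset_trans)+
  then show ?thesis
    using assms by (simp add: less_imp_neq)
qed

theorem theorem1p4:
  fixes sX :: "'k::{real_normed_field,euclidean_space} \<Rightarrow> 'x::banach \<Rightarrow> 'x"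
    and sY :: "'k \<Rightarrow> 'y::banach \<Rightarrow> 'y"
    and b :: "nat \<Rightarrow> 'x"
    and Y :: "'x set"
    and J :: "'y \<Rightarrow>\<^sub>L 'x"
  assumes X: "kbanach sX" "very_few_operators sX" "shrinking_basis sX b" "dual_iso_l1 sX"
    and Y: "module.subspace sX Y" "closed Y"
    and J: "kbanach sY" "J \<in> bounded_ops sY sX" "\<And>y. norm (blinfun_apply J y) = norm y"
      "range (blinfun_apply J) = Y"
    and Y_infinite_dim: "infinite_dim sY"
    and i: "\<exists>r :: nat \<Rightarrow> nat. strict_mono r \<and> Y = closure (module.span sX (range (b \<circ> r)))"
    and ii: "infinite_codim sX Y"
    and iii: "dual_iso_l1 sY"
    and iv: "\<forall>T \<in> bounded_ops sY sX. \<exists>c. \<exists>K \<in> compact_ops sY sX.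
      \<forall>y. blinfun_apply T y = sX c (blinfun_apply J y) + blinfun_apply K y"
  shows "let sZ = ms_scale sX sY;
          B = bounded_ops sZ sZ;
          K = compact_ops sZ sZ;
          E = inessential_ops sZ;
          M\<^sub>1 = M1 sX sY J;
          M\<^sub>2 = M2 sX sY J
      in closed_ideals sZ = {{0}, K, E, M\<^sub>1, M\<^sub>2, B} \<and>
         card (closed_ideals sZ) = 6 \<and>
         E = M\<^sub>1 \<inter> M\<^sub>2 \<and>
         {0} \<subset> K \<and> K \<subset> E \<and>
         E \<subset> M\<^sub>1 \<and> M\<^sub>1 \<subset> B \<and>
         E \<subset> M\<^sub>2 \<and> M\<^sub>2 \<subset> B \<and>
         \<not> M\<^sub>1 \<subseteq> M\<^sub>2 \<and> \<not> M\<^sub>2 \<subseteq> M\<^sub>1"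
proof -
  interpret few_operator_pair sX sY J
  proof (intro few_operator_pair.intro isometric_embedding.intro isometric_embedding_axioms.intro
      few_operator_pair_axioms.intro)
    show "infinite_codim sX (range (blinfun_apply J))"
      using ii J(4) by simp
  qed (use X J Y_infinite_dim iv in auto)
  obtain r :: "nat \<Rightarrow> nat" where "Y = closure (module.span sX (range (b \<circ> r)))"
    using i by blast
  then have "range (blinfun_apply J) = closure (module.span sX (b ` range r))"
    using J(4) by (simp add: image_comp)
  moreover have "schauder_basis sX b"
    using X(3) by (simp add: shrinking_basis_def)
  ultimately obtain R C where approx: "bounded_approximation sZ R C"
    using bounded_approximation_maxsum by blast
  interpret bounded_approximation sZ R C
    by (rule approx)
  define I\<^sub>1 I\<^sub>2 where "I\<^sub>1 = M1 sX sY J" and "I\<^sub>2 = M2 sX sY J"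
  have E: "inessential_ops sZ = I\<^sub>1 \<inter> I\<^sub>2"
    using inessential_ops_eq[OF approx] by (simp add: I\<^sub>1_def I\<^sub>2_def)
  have ideals: "closed_ideals sZ = {{0}, K, I\<^sub>1 \<inter> I\<^sub>2, I\<^sub>1, I\<^sub>2, B}"
    using closed_ideals_eq[OF approx] by (simp add: I\<^sub>1_def I\<^sub>2_def)
  note mem = E_mem[folded I\<^sub>1_def I\<^sub>2_def]
  \<comment> \<open>Without nonzero compact operators all \<open>R n\<close> would vanish, and with
    them their pointwise limit, the identity; but then \<open>E12\<close> would be 0 and hence
    compact.\<close>
  have "K \<noteq> {0}"
  proof
    assume "K = {0}"
    then have "R n = 0" for n
      using finite_rank_imp_compact[OF kZ finite_rank] by blast
    then have "z = 0" for z :: "('x, 'y) maxsum"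
      using pointwise[of z] by (simp add: LIMSEQ_const_iff)
    then have "E12 = 0"
      by (metis blinfun_eqI)
    then show False
      using mem(5) compact_ops_zero[OF kZ] by metis
  qed
  then have 1: "{0} \<subset> K"
    using compact_ops_zero[OF kZ] by auto
  have 2: "K \<subset> I\<^sub>1 \<inter> I\<^sub>2"
    using K_subset mem by (auto simp: I\<^sub>1_def I\<^sub>2_def)
  have 3: "I\<^sub>1 \<subset> B" "I\<^sub>2 \<subset> B"
    using mem E_bounded_ops by (auto simp: I\<^sub>1_def I\<^sub>2_def M1_def M2_def)
  have 4: "\<not> I\<^sub>1 \<subseteq> I\<^sub>2" "\<not> I\<^sub>2 \<subseteq> I\<^sub>1"
    using mem by auto
  have 5: "I\<^sub>1 \<inter> I\<^sub>2 \<subset> I\<^sub>1" "I\<^sub>1 \<inter> I\<^sub>2 \<subset> I\<^sub>2"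
    using 4 by auto
  have "card (closed_ideals sZ) = 6"
    unfolding ideals by (rule card_six_sets[OF 1 2 5(1) 3(1) 5(2) 3(2) 4])
  then show ?thesis
    unfolding Let_def E I\<^sub>1_def[symmetric] I\<^sub>2_def[symmetric]
    using ideals 1 2 3 4 5 by (intro conjI) simp_all
qed

end
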